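(* Let $h>0$, let $(w_h,\lambda_h)\in\mathcal C_b(E)\times\mathbb R$ be a solution to $$w_h(x)=\min\bigl(g(x)-\lambda_h+\mathbb E_x[w_h(X_h)],\,M_hw_h(x)\bigr),\quad x\in E,\qquad M_hw_h(x):=\inf_{\xi\in U}\Bigl(\tfrac1h c(x,\xi)+w_h(\xi)\Bigr),$$ and let $\hat V_h=(\hat\sigma_i,\hat\xi_i)_{i=1}^\infty\in\mathbb V_h$ be the associated strategy: $\hat\sigma_0\equiv0$ and, for $i\ge1$, $$\hat\sigma_i:=h\inf\{n\in\mathbb N: n\ge\hat\sigma_{i-1}/h,\ w_h(X^i_{nh})=M_hw_h(X^i_{nh})\},$$ $$\hat\xi_i:=\arg\min_{\xi\in U}\Bigl(\tfrac1h c(X^i_{\hat\sigma_i},\xi)+w_h(\xi)\Bigr)1_{\{\hat\sigma_i<\infty\}}+\xi_0\,1_{\{\hat\sigma_i=\infty\}},$$ where $\xi_0\in U$ is some fixed point. Then $$\inf_{V\in\mathbb V_h}J^d_h(x,V)=J^d_h(x,\hat V_h)=\lambda_h=\inf_{V\in\mathbb V_h}J_h(x,V),\qquad x\in E.$$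
   Context: Conventions: $\mathbb N=\{0,1,2,\dots\}$, $\inf\emptyset:=\infty$, $\sum_{i=0}^{-1}(\cdot):=0$; $\mathcal C_b(Z)$ is the space of bounded continuous real functions on the metric space $Z$; $\arg\min$ denotes a (measurably selected) minimiser. Process. $X=(X_t)_{t\ge0}$ is a continuous-time standard Feller–Markov process on a filtered space $(\Omega,\mathcal F,(\mathcal F_t))$ (standard in the usual sense of Markov process theory) with values in a locally compact separable metric space $E$ with Borel $\sigma$-field $\mathcal E$; $\mathbb P_x,\mathbb E_x$ are the law and expectation for the process started at $x\in E$, and $P_t(x,A):=\mathbb P_x[X_t\in A]$. The set $U\subset E$ of admissible after-impulse states is a (nonempty) compact set. Standing assumptions. (1) $\beta:[0,\infty)\to(0,1]$ is weakly decreasing and continuous, $\beta(0)=1$, $\beta(t+s)\ge\beta(t)\beta(s)$ for all $t,s\ge0$, and $\int_0^\infty\beta(s)ds=\infty$. (2) $g:E\to\mathbb R$ is continuous and bounded; $c:E\times U\to\mathbb R_+$ is continuous and bounded, and for some $c_0>0$ we have $0<c_0\le c(x,\xi)\le c(x,\eta)+c(\eta,\xi)$ for $x\in E$, $\xi,\eta\in U$. (3) For every $f\in\mathcal C_b(E)$ and $t>0$, the map $x\mapsto\mathbb E_x[f(X_t)]$ is in $\mathcal C_b(E)$. (4) For every $t>0$ there is $\Lambda_t\in(0,1)$ with $\sup_{x,y\in E}\sup_{A\in\mathcal E}|P_t(x,A)-P_t(y,A)|\le\Lambda_t$. Impulse control. A strategy is a sequence $V=(\tau_i,\xi_i)_{i=1}^\infty$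 with $(\tau_i)$ an increasing (weakly, values in $[0,\infty]$) sequence of stopping times and $\xi_i$ $\mathcal F_{\tau_i}$-measurable $U$-valued random variables. On a countable product of copies of $(\Omega,\mathcal F,(\mathcal F_t))$ with coordinate process $(X^1_t,X^2_t,\dots)$, to each $x\in E$ and $V$ one associates a probability $\mathbb P^V_x$ (expectation $\mathbb E^V_x$) under which $X^1$ follows the uncontrolled dynamics from $x$ and, for each $i\ge1$, on $\{\tau_i<\infty\}$, $X^{i+1}_{\tau_i}=\xi_i$ and from time $\tau_i$ on $X^{i+1}$ follows the uncontrolled dynamics started afresh from $\xi_i$ (conditionally on the past). The controlled process is $Y_t:=X^i_t$ for $t\in[\tau_{i-1},\tau_i)$, $\tau_0\equiv0$. $\mathbb V$ is the family of all strategies; $\mathbb V_h\subset\mathbb V$ those with impulse times restricted to $\{0,h,2h,\dots\}$ (or $\infty$, i.e. no impulse). Functionals. With $\varphi_h(i):=\frac1h\int_{ih}^{(i+1)h}\beta(s)ds$, $i\in\mathbb N$, for $x\in E$ and $V\in\mathbb V_h$, $$J^d_h(x,V):=\limsup_{n\to\infty}\frac{\mathbb E^V_x\bigl[\sum_{i=0}^{n-1}\varphi_h(i)g(Y_{ih})+\sum_{i=1}^\infty1_{\{\tau_i\le nh\}}\frac1h\varphi_h(\tau_i/h)c(X^i_{\tau_i},X^{i+1}_{\tau_i})\bigr]}{\sum_{i=0}^{n-1}\varphi_h(i)},$$ $$J_h(x,V):=\limsup_{n\to\infty}\frac1n\mathbb E^V_x\Bigl[\sum_{i=1}^{n}g(Y_{ih})+\sum_{i=1}^\infty1_{\{\tau_i\le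 nh\}}\tfrac1h c(X^i_{\tau_i},X^{i+1}_{\tau_i})\Bigr].$$ *)

theory Defs
  imports "HOL-Probability.Probability"
begin

text \<open>
  Time runs through \<^typ>\<open>ennreal\<close> for filtrations and stopping times (so that the library notions
  cover stopping times with values in \<open>[0, \<infinity>]\<close>) and through the nonnegative reals for the process.
  Filtrations are indexed by \<open>[0, \<infinity>]\<close> with the convention that the \<open>\<sigma>\<close>-field at \<open>\<infinity>\<close> is
  the whole \<open>\<sigma>\<close>-field, so that \<^const>\<open>filtration.pre_sigma\<close> is the usual \<open>\<sigma>\<close>-field of a
  stopping time.
\<close>

section \<open>Standard Markov processes\<close>

definition trans_prob :: "('e \<Rightarrow> 'w measure) \<Rightarrow> (real \<Rightarrow> 'w \<Rightarrow> 'e) \<Rightarrow> real \<Rightarrow> 'e \<Rightarrow> 'e set \<Rightarrow> real" where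
  "trans_prob P X t x B = measure (P x) {\<omega> \<in> space (P x). X t \<omega> \<in> B}"

text \<open>
  The process \<open>Z\<close>, under the law \<open>N\<close> and relative to the filtration \<open>G\<close>, has the Markov property
  with transition function \<open>p\<close> at the random time \<open>T\<close>: on \<open>{T < \<infinity>}\<close>, the conditional
  probability of \<open>Z (T + t) \<in> B\<close> given the \<open>\<sigma>\<close>-field of \<open>T\<close> is \<open>p t (Z T) B\<close>.
\<close>

definition markov_at ::
  "(real \<Rightarrow> 'e::topological_space \<Rightarrow> 'e set \<Rightarrow> real) \<Rightarrow> 'a measure \<Rightarrow> (ennreal \<Rightarrow> 'a measure) \<Rightarrow>
    (real \<Rightarrow> 'a \<Rightarrow> 'e) \<Rightarrow> ('a \<Rightarrow> ennreal) \<Rightarrow> bool" where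
  "markov_at p N G Z T \<longleftrightarrow>
    (\<forall>t\<ge>0. \<forall>B\<in>sets borel. \<forall>A\<in>sets (filtration.pre_sigma (space N) G T).
      measure N {\<omega> \<in> A. T \<omega> < \<top> \<and> Z (enn2real (T \<omega>) + t) \<omega> \<in> B} =
      (LINT \<omega>:{\<omega> \<in> A. T \<omega> < \<top>}|N. p t (Z (enn2real (T \<omega>)) \<omega>) B))"

text \<open>
  Standard processes of infinite lifetime: normal, right-continuous with left limits, strongly
  Markov and quasi-left-continuous with respect to a right-continuous filtration. The filtration is
  not required to be completed: completion is incompatible with laws on the same filtered
  space under which the process is restarted at a prescribed point at a later time, since such laws
  live on events that are null for every \<open>P x\<close>.
\<close>

locale standard_markov_process = filtration "space M" F
  for M :: "'w measure" and F :: "ennreal \<Rightarrow> 'w measure" +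
  fixes X :: "real \<Rightarrow> 'w \<Rightarrow> 'e::{metric_space, second_countable_topology}"
    and P :: "'e \<Rightarrow> 'w measure"
  assumes sets_F_top: "sets (F \<top>) = sets M"
    and F_right_continuous: "\<And>t. t < \<top> \<Longrightarrow> sets (F t) = (\<Inter>u\<in>{t<..}. sets (F u))"
    and adapted: "\<And>t. 0 \<le> t \<Longrightarrow> X t \<in> F (ennreal t) \<rightarrow>\<^sub>M borel"
    and prob_space_P: "\<And>x. prob_space (P x)"
    and sets_P: "\<And>x. sets (P x) = sets M"
    and kernel: "\<And>t B. 0 \<le> t \<Longrightarrow> B \<in> sets borel \<Longrightarrow>
      (\<lambda>x. trans_prob P X t x B) \<in> borel_measurable borel"
    and normal: "\<And>x. AE \<omega> in P x. X 0 \<omega> = x"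
    and right_continuous: "\<And>\<omega> t. \<omega> \<in> space M \<Longrightarrow> 0 \<le> t \<Longrightarrow> continuous (at_right t) (\<lambda>s. X s \<omega>)"
    and left_limits: "\<And>x. AE \<omega> in P x. \<forall>t>0. \<exists>l. ((\<lambda>s. X s \<omega>) \<longlongrightarrow> l) (at_left t)"
    and strong_markov: "\<And>x T. stopping_time F T \<Longrightarrow> markov_at (trans_prob P X) (P x) F X T"
    and quasi_left_continuous: "\<And>x T. (\<And>n::nat. stopping_time F (T n)) \<Longrightarrow>
      (\<And>\<omega>. \<omega> \<in> space M \<Longrightarrow> incseq (\<lambda>n. T n \<omega>)) \<Longrightarrow>
      AE \<omega> in P x. (SUP n. T n \<omega>) < \<top> \<longrightarrow>
        (\<lambda>n. X (enn2real (T n \<omega>)) \<omega>) \<longlonglongrightarrow> X (enn2real (SUP n. T n \<omega>)) \<omega>"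


section \<open>Impulse strategies and controlled laws\<close>

text \<open>
  The countable product of copies of \<open>\<Omega>\<close> is indexed by \<open>{1..}\<close>; the coordinate process
  \<open>X\<^sup>i\<close> at time \<open>t\<close> is \<open>X t (\<omega> i)\<close>.
\<close>

abbreviation path_space :: "'w measure \<Rightarrow> (nat \<Rightarrow> 'w) measure" where
  "path_space M \<equiv> PiM {1..} (\<lambda>_. M)"

text \<open>
  \<open>coord_filtration M F i\<close> is the filtration of the first \<open>i\<close> coordinates. The impulse \<open>i\<close> is
  decided upon from these coordinates only, since the law of coordinate \<open>i + 1\<close> depends on it.
\<close>

definition coord_filtration ::
  "'w measure \<Rightarrow> (ennreal \<Rightarrow> 'w measure) \<Rightarrow> nat \<Rightarrow> ennreal \<Rightarrow> (nat \<Rightarrow> 'w) measure" where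
  "coord_filtration M F i t =
    vimage_algebra (space (path_space M)) (\<lambda>\<omega>. restrict \<omega> {1..i}) (PiM {1..i} (\<lambda>_. F t))"

text \<open>
  A strategy is the pair \<open>(\<tau>, \<xi>)\<close> of the sequences of impulse times and after-impulse states,
  of which the entries \<open>i \<ge> 1\<close> are relevant, together with the convention \<open>\<tau> 0 = 0\<close>.
\<close>

type_synonym ('w, 'e) strategy =
  "(nat \<Rightarrow> (nat \<Rightarrow> 'w) \<Rightarrow> ennreal) \<times> (nat \<Rightarrow> (nat \<Rightarrow> 'w) \<Rightarrow> 'e)"

definition strategies ::
  "'w measure \<Rightarrow> (ennreal \<Rightarrow> 'w measure) \<Rightarrow> 'e::topological_space set \<Rightarrow> ('w, 'e) strategy set" where
  "strategies M F U = {(\<tau>, \<xi>).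
    (\<forall>\<omega>\<in>space (path_space M). \<tau> 0 \<omega> = 0 \<and> incseq (\<lambda>i. \<tau> i \<omega>)) \<and>
    (\<forall>i\<ge>1. stopping_time (coord_filtration M F i) (\<tau> i) \<and>
      \<xi> i \<in> filtration.pre_sigma (space (path_space M)) (coord_filtration M F i) (\<tau> i) \<rightarrow>\<^sub>M borel \<and>
      (\<forall>\<omega>\<in>space (path_space M). \<xi> i \<omega> \<in> U))}"

definition grid_strategies ::
  "'w measure \<Rightarrow> (ennreal \<Rightarrow> 'w measure) \<Rightarrow> 'e::topological_space set \<Rightarrow> real \<Rightarrow>
    ('w, 'e) strategy set" where
  "grid_strategies M F U h = {(\<tau>, \<xi>). (\<tau>, \<xi>) \<in> strategies M F U \<and>
    (\<forall>i\<ge>1. \<forall>\<omega>\<in>space (path_space M). \<tau> i \<omega> \<in> insert \<top> (range (\<lambda>n::nat. ennreal (real n * h))))}"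

text \<open>
  \<open>N\<close> is a law of the process started at \<open>x\<close> and controlled by the given strategy: \<open>X\<^sup>1\<close> has
  the law \<open>P x\<close>, and for \<open>i \<ge> 1\<close>, on \<open>{\<tau>\<^sub>i < \<infinity>}\<close>, the process \<open>X\<^bsup>i+1\<^esup>\<close> is at \<open>\<xi>\<^sub>i\<close> at
  time \<open>\<tau>\<^sub>i\<close> and from then on Markov with the uncontrolled transition function relative to the
  filtration of the first \<open>i + 1\<close> coordinates.
\<close>

definition controlled_law ::
  "'w measure \<Rightarrow> (ennreal \<Rightarrow> 'w measure) \<Rightarrow> (real \<Rightarrow> 'w \<Rightarrow> 'e::topological_space) \<Rightarrow>
    ('e \<Rightarrow> 'w measure) \<Rightarrow> 'e \<Rightarrow> ('w, 'e) strategy \<Rightarrow> (nat \<Rightarrow> 'w) measure \<Rightarrow> bool" where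
  "controlled_law M F X P x = (\<lambda>(\<tau>, \<xi>) N.
    prob_space N \<and> sets N = sets (path_space M) \<and> distr N M (\<lambda>\<omega>. \<omega> 1) = P x \<and>
    (\<forall>i\<ge>1. (AE \<omega> in N. \<tau> i \<omega> < \<top> \<longrightarrow> X (enn2real (\<tau> i \<omega>)) (\<omega> (i + 1)) = \<xi> i \<omega>) \<and>
      (\<forall>s\<ge>0. markov_at (trans_prob P X) N (coord_filtration M F (i + 1))
        (\<lambda>t \<omega>. X t (\<omega> (i + 1))) (\<lambda>\<omega>. \<tau> i \<omega> + ennreal s))))"

definition controlled_process ::
  "(real \<Rightarrow> 'w \<Rightarrow> 'e) \<Rightarrow> (nat \<Rightarrow> (nat \<Rightarrow> 'w) \<Rightarrow> ennreal) \<Rightarrow> real \<Rightarrow> (nat \<Rightarrow> 'w) \<Rightarrow> 'e" where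
  "controlled_process X \<tau> t \<omega> =
    X t (\<omega> (THE i. 1 \<le> i \<and> \<tau> (i - 1) \<omega> \<le> ennreal t \<and> ennreal t < \<tau> i \<omega>))"


section \<open>Cost functionals\<close>

text \<open>Only the values at natural numbers matter.\<close>

definition phi :: "(real \<Rightarrow> real) \<Rightarrow> real \<Rightarrow> real \<Rightarrow> real" where
  "phi \<beta> h r = 1 / h * integral {r * h..(r + 1) * h} \<beta>"

text \<open>
  The impulse cost up to time \<open>n h\<close>, where \<open>\<rho> s\<close> is the weight of an impulse at time \<open>s\<close>. Being a
  sum of nonnegative terms, it is taken in \<^typ>\<open>ennreal\<close>, as is its expectation below, which is then
  added to the expectation of the bounded part.
\<close>

definition impulse_cost ::
  "(real \<Rightarrow> 'w \<Rightarrow> 'e) \<Rightarrow> ('e \<Rightarrow> 'e \<Rightarrow> real) \<Rightarrow> (real \<Rightarrow> real) \<Rightarrow>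
    (nat \<Rightarrow> (nat \<Rightarrow> 'w) \<Rightarrow> ennreal) \<Rightarrow> ennreal \<Rightarrow> (nat \<Rightarrow> 'w) \<Rightarrow> ennreal" where
  "impulse_cost X c \<rho> \<tau> T \<omega> =
    (\<Sum>k. let i = Suc k; s = enn2real (\<tau> i \<omega>) in
      if \<tau> i \<omega> \<le> T then ennreal (\<rho> s * c (X s (\<omega> i)) (X s (\<omega> (i + 1)))) else 0)"

text \<open>In both functionals, \<open>N x V\<close> is the law of the process started at \<open>x\<close> and controlled by \<open>V\<close>.\<close>

definition J_disc ::
  "(real \<Rightarrow> 'w \<Rightarrow> 'e) \<Rightarrow> ('e \<Rightarrow> real) \<Rightarrow> ('e \<Rightarrow> 'e \<Rightarrow> real) \<Rightarrow> (real \<Rightarrow> real) \<Rightarrow>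
    ('e \<Rightarrow> ('w, 'e) strategy \<Rightarrow> (nat \<Rightarrow> 'w) measure) \<Rightarrow> real \<Rightarrow> 'e \<Rightarrow> ('w, 'e) strategy \<Rightarrow> ereal" where
  "J_disc X g c \<beta> N h x V = limsup (\<lambda>n.
    (ereal (\<integral>\<omega>. (\<Sum>i<n. phi \<beta> h (real i) * g (controlled_process X (fst V) (real i * h) \<omega>)) \<partial>N x V)
     + enn2ereal (\<integral>\<^sup>+\<omega>. impulse_cost X c (\<lambda>s. 1 / h * phi \<beta> h (s / h)) (fst V)
         (ennreal (real n * h)) \<omega> \<partial>N x V))
    / ereal (\<Sum>i<n. phi \<beta> h (real i)))"

definition J_avg ::
  "(real \<Rightarrow> 'w \<Rightarrow> 'e) \<Rightarrow> ('e \<Rightarrow> real) \<Rightarrow> ('e \<Rightarrow> 'e \<Rightarrow> real) \<Rightarrow>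
    ('e \<Rightarrow> ('w, 'e) strategy \<Rightarrow> (nat \<Rightarrow> 'w) measure) \<Rightarrow> real \<Rightarrow> 'e \<Rightarrow> ('w, 'e) strategy \<Rightarrow> ereal" where
  "J_avg X g c N h x V = limsup (\<lambda>n.
    (ereal (\<integral>\<omega>. (\<Sum>i=1..n. g (controlled_process X (fst V) (real i * h) \<omega>)) \<partial>N x V)
     + enn2ereal (\<integral>\<^sup>+\<omega>. impulse_cost X c (\<lambda>s. 1 / h) (fst V) (ennreal (real n * h)) \<omega> \<partial>N x V))
    / ereal (real n))"


section \<open>The impulse operator and the associated strategy\<close>

definition impulse_op ::
  "('e \<Rightarrow> 'e \<Rightarrow> real) \<Rightarrow> 'e set \<Rightarrow> real \<Rightarrow> ('e \<Rightarrow> real) \<Rightarrow> 'e \<Rightarrow> real" where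
  "impulse_op c U h w x = (INF \<xi>\<in>U. 1 / h * c x \<xi> + w \<xi>)"

text \<open>Infima in \<^typ>\<open>ennreal\<close>: the infimum of the empty set is \<open>\<infinity>\<close>, and \<open>h \<cdot> \<infinity> = \<infinity>\<close> for \<open>h > 0\<close>.\<close>

primrec opt_time ::
  "(real \<Rightarrow> 'w \<Rightarrow> 'e) \<Rightarrow> ('e \<Rightarrow> 'e \<Rightarrow> real) \<Rightarrow> 'e set \<Rightarrow> real \<Rightarrow> ('e \<Rightarrow> real) \<Rightarrow>
    nat \<Rightarrow> (nat \<Rightarrow> 'w) \<Rightarrow> ennreal" where
  "opt_time X c U h w 0 = (\<lambda>\<omega>. 0)"
| "opt_time X c U h w (Suc i) = (\<lambda>\<omega>.
    ennreal h * (INF n\<in>{n::nat. opt_time X c U h w i \<omega> / ennreal h \<le> of_nat n \<and>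
      w (X (real n * h) (\<omega> (Suc i))) = impulse_op c U h w (X (real n * h) (\<omega> (Suc i)))}. of_nat n))"

text \<open>\<open>sel\<close> is a selector of minimisers and \<open>\<xi>\<^sub>0\<close> the state used when there is no impulse.\<close>

definition opt_strategy ::
  "(real \<Rightarrow> 'w \<Rightarrow> 'e) \<Rightarrow> ('e \<Rightarrow> 'e \<Rightarrow> real) \<Rightarrow> 'e set \<Rightarrow> real \<Rightarrow> ('e \<Rightarrow> real) \<Rightarrow>
    ('e \<Rightarrow> 'e) \<Rightarrow> 'e \<Rightarrow> ('w, 'e) strategy" where
  "opt_strategy X c U h w sel \<xi>\<^sub>0 =
    (opt_time X c U h w,
     \<lambda>i \<omega>. if opt_time X c U h w i \<omega> < \<top>
       then sel (X (enn2real (opt_time X c U h w i \<omega>)) (\<omega> i)) else \<xi>\<^sub>0)"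

end

theory Submission
  imports Defs
begin

text \<open>
  The proof is a verification argument along the time grid. Just before the impulses at time
  \<open>n h\<close> the controlled process is in a state \<open>Z\<^sub>n\<close> (\<open>pre_state\<close>), just after them in a state
  \<open>Y\<^sub>n\<close> (\<open>post_state\<close>). Between two grid points the process is uncontrolled, so
  \<open>\<^bold>E w (Z\<^bsub>n+1\<^esub>) = \<^bold>E (P\<^sub>h w) (Y\<^sub>n)\<close> (\<open>expectation_pre_state_Suc\<close>), where \<open>P\<^sub>h\<close> denotes the
  transition operator. Along a path, \<open>w (Z\<^sub>n) - w (Y\<^sub>n)\<close> telescopes over the impulses
  at time \<open>n h\<close> (\<open>sum_jumps_eq_sum_impulses\<close>). The Bellman equation contains two inequalities:
  \<open>w \<le> M w\<close> says that every impulse costs at least the drop of \<open>w\<close> that it causes, and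
  \<open>w \<le> g - \<lambda> + P\<^sub>h w\<close> bounds the running cost from below by \<open>\<lambda> + w - P\<^sub>h w\<close>. Added up with
  decreasing weights \<open>\<rho> i\<close>, the expected cost up to time \<open>n h\<close> is at least
  \<open>\<lambda> (\<Sum>i<n. \<rho> i) + (\<Sum>i<n. \<rho> i (a i - a (i + 1)))\<close> up to a boundary term, where
  \<open>a i = \<^bold>E w (Z\<^sub>i)\<close> is bounded. By Abel summation the last sum is bounded uniformly in \<open>n\<close>
  because the weights decrease, so it disappears after division by \<open>\<Sum>i<n. \<rho> i\<close>, which tends to
  infinity. This bounds both functionals from below by \<open>\<lambda>\<close> (\<open>expected_total_cost_lower\<close>):
  the discounted one has the weights \<open>phi \<beta> h i\<close>, the average one the weights \<open>1\<close>.

  For the strategy associated with \<open>w\<close> both inequalities are equalities along almost every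
  path: impulses take place exactly when \<open>w = M w\<close> and go to a minimiser, and no impulse is left
  to be made when the process is handed back to its own dynamics
  (\<open>opt_strategy_jump\<close>, \<open>opt_strategy_wait\<close>). Hence it attains \<open>\<lambda>\<close> in both functionals
  (\<open>expected_total_cost_upper\<close>).

  The identities need paths with finitely many impulses up to time \<open>n h\<close>. A strategy that
  violates this with positive probability has infinite expected cost, since impulse costs are
  bounded away from zero; for the associated strategy such a path would decrease the bounded
  function \<open>w\<close> infinitely often by a fixed amount (\<open>AE_unfinished\<close>).
\<close>

section \<open>Grid-valued random times and the Markov property at a constant time\<close>

text \<open>
  Expresses a single value of a grid-valued time through the events \<open>T \<le> t\<close>, which are what a
  stopping time makes measurable.
\<close>

lemma grid_time_eq_set:
  fixes T :: "'a \<Rightarrow> ennreal"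
  assumes h: "0 < h"
    and T: "\<And>\<omega>. \<omega> \<in> \<Omega> \<Longrightarrow> T \<omega> < \<top> \<Longrightarrow> \<exists>n::nat. T \<omega> = ennreal (real n * h)"
  shows "{\<omega> \<in> \<Omega>. T \<omega> = ennreal (real m * h)} =
    {\<omega> \<in> \<Omega>. T \<omega> \<le> ennreal (real m * h)} - (\<Union>l<m. {\<omega> \<in> \<Omega>. T \<omega> \<le> ennreal (real l * h)})"
    (is "?l = ?r")
proof (rule set_eqI, rule iffI)
  fix \<omega> assume \<omega>: "\<omega> \<in> ?l"
  have "\<not> ennreal (real m * h) \<le> ennreal (real l * h)" if "l < m" for l
    using that h by (auto simp: ennreal_le_iff2 zero_less_mult_iff mult_le_0_iff)
  then show "\<omega> \<in> ?r" using \<omega> by auto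
next
  fix \<omega> assume \<omega>: "\<omega> \<in> ?r"
  then have "\<omega> \<in> \<Omega>" "T \<omega> < \<top>"
    by (auto intro: le_less_trans)
  then obtain l where l: "T \<omega> = ennreal (real l * h)"
    using T by blast
  have "\<not> l < m"
    using \<omega> l by auto
  moreover have "l \<le> m"
    using \<omega> l h by (auto simp: ennreal_le_iff2 mult_le_0_iff)
  ultimately show "\<omega> \<in> ?l"
    using \<omega> l by auto
qed

text \<open>
  Only the values of \<open>T\<close> on \<open>A\<close> matter, which makes it possible to freeze a random time on an event
  where it is constant.
\<close>

lemma pre_sigma_constI:
  assumes A: "A \<in> sets (F' t)" and T: "\<And>\<omega>. \<omega> \<in> A \<Longrightarrow> T \<omega> = t" and F': "filtration \<Omega> F'"
  shows "A \<in> sets (filtration.pre_sigma \<Omega> F' T)"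
proof -
  interpret F': filtration \<Omega> F' by (rule F')
  have "{\<omega> \<in> A. T \<omega> \<le> s} \<in> sets (F' s)" for s
  proof (cases "t \<le> s")
    case True
    then have "{\<omega> \<in> A. T \<omega> \<le> s} = A"
      using T by auto
    then show ?thesis
      using A F'.sets_F_mono[OF True] by auto
  next
    case False
    then have "{\<omega> \<in> A. T \<omega> \<le> s} = {}"
      using T by auto
    then show ?thesis by (metis sets.empty_sets)
  qed
  moreover have "{A. \<forall>t. {\<omega> \<in> A. T \<omega> \<le> t} \<in> sets (F' t)} \<subseteq> Pow \<Omega>"
  proof safe
    fix A y assume "\<forall>t. {\<omega> \<in> A. T \<omega> \<le> t} \<in> sets (F' t)" "y \<in> A"
    then have "{\<omega> \<in> A. T \<omega> \<le> T y} \<subseteq> \<Omega>"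
      using sets.sets_into_space[of "{\<omega> \<in> A. T \<omega> \<le> T y}" "F' (T y)"] F'.space_F by auto
    then show "y \<in> \<Omega>"
      using \<open>y \<in> A\<close> by auto
  qed
  ultimately show ?thesis
    unfolding F'.pre_sigma_def by (simp add: sets_measure_of sigma_sets.Basic)
qed

text \<open>
  The form in which the Markov property is used throughout: at a fixed time \<open>s\<close>, on an event
  on which \<open>T\<close> takes the value \<open>s\<close>.
\<close>

lemma markov_atD:
  assumes "markov_at p N' F' Z T" "0 \<le> t" "B \<in> sets borel" "0 \<le> s"
    and A: "A \<in> sets (F' (ennreal s))" "A \<in> sets N'" and T: "\<And>\<omega>. \<omega> \<in> A \<Longrightarrow> T \<omega> = ennreal s"
    and F': "filtration (space N') F'"
  shows "measure N' {\<omega> \<in> A. Z (s + t) \<omega> \<in> B} = (LINT \<omega>:A|N'. p t (Z s \<omega>) B)"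
proof -
  have "A \<in> sets (filtration.pre_sigma (space N') F' T)"
    by (rule pre_sigma_constI[OF A(1) T F'])
  then have "measure N' {\<omega> \<in> A. T \<omega> < \<top> \<and> Z (enn2real (T \<omega>) + t) \<omega> \<in> B} =
      (LINT \<omega>:{\<omega> \<in> A. T \<omega> < \<top>}|N'. p t (Z (enn2real (T \<omega>)) \<omega>) B)"
    using assms(1-3) unfolding markov_at_def by blast
  moreover have "{\<omega> \<in> A. T \<omega> < \<top> \<and> Z (enn2real (T \<omega>) + t) \<omega> \<in> B} = {\<omega> \<in> A. Z (s + t) \<omega> \<in> B}"
    using T \<open>0 \<le> s\<close> by auto
  moreover have "{\<omega> \<in> A. T \<omega> < \<top>} = A"
    using T by auto
  moreover have "(LINT \<omega>:A|N'. p t (Z (enn2real (T \<omega>)) \<omega>) B) = (LINT \<omega>:A|N'. p t (Z s \<omega>) B)"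
    using T A(2) \<open>0 \<le> s\<close> by (intro set_lebesgue_integral_cong) auto
  ultimately show ?thesis by simp
qed

section \<open>The filtration of the first coordinates and the transition kernel\<close>

context standard_markov_process
begin

lemma sets_F_le: "sets (F t) \<subseteq> sets M"
  using sets_F_mono[of t \<top>] sets_F_top by simp

lemma space_coord_filtration [simp]: "space (coord_filtration M F i t) = space (path_space M)"
  by (simp add: coord_filtration_def)

lemma restrict_in_space_PiM:
  assumes "\<omega> \<in> space (path_space M)"
  shows "restrict \<omega> {1..i} \<in> space (PiM {1..i} (\<lambda>_. F t))"
  using assms by (auto simp: space_PiM space_F)

lemma coord_filtration_measurable_comp:
  assumes f: "f \<in> F t \<rightarrow>\<^sub>M L" and k: "1 \<le> k" "k \<le> i"
  shows "(\<lambda>\<omega>. f (\<omega> k)) \<in> coord_filtration M F i t \<rightarrow>\<^sub>M L"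
proof -
  have 1: "(\<lambda>\<omega>. restrict \<omega> {1..i}) \<in> coord_filtration M F i t \<rightarrow>\<^sub>M PiM {1..i} (\<lambda>_. F t)"
    unfolding coord_filtration_def
    by (rule measurable_vimage_algebra1) (use restrict_in_space_PiM in blast)
  have 2: "(\<lambda>\<omega>. \<omega> k) \<in> PiM {1..i} (\<lambda>_. F t) \<rightarrow>\<^sub>M F t"
    using k by (intro measurable_component_singleton) auto
  have "(\<lambda>\<omega>. f (restrict \<omega> {1..i} k)) \<in> coord_filtration M F i t \<rightarrow>\<^sub>M L"
    using measurable_compose[OF measurable_compose[OF 1 2] f] .
  then show ?thesis
    using k by simp
qed

text \<open>
  The restriction to the first \<open>i\<close> coordinates at time \<open>s\<close> is measurable with respect to the larger
  filtration, and \<open>coord_filtration\<close> is the smallest \<open>\<sigma>\<close>-field with this property.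
\<close>

lemma coord_filtration_mono:
  assumes "i \<le> j" "s \<le> t"
  shows "sets (coord_filtration M F i s) \<subseteq> sets (coord_filtration M F j t)"
proof -
  have id: "(\<lambda>x. x) \<in> F t \<rightarrow>\<^sub>M F s"
    using sets_F_mono[OF assms(2)] by (intro measurableI) (auto simp: space_F)
  have "(\<lambda>\<omega>. restrict \<omega> {1..i}) \<in> coord_filtration M F j t \<rightarrow>\<^sub>M PiM {1..i} (\<lambda>_. F s)"
    using assms(1) by (intro measurable_restrict coord_filtration_measurable_comp[OF id]) auto
  then have "(\<lambda>\<omega>. \<omega>) \<in> coord_filtration M F j t \<rightarrow>\<^sub>M coord_filtration M F i s"
    unfolding coord_filtration_def[of M F i s] by (intro measurable_vimage_algebra2) auto
  then have "A \<in> sets (coord_filtration M F j t)" if "A \<in> sets (coord_filtration M F i s)" for A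
    using measurable_sets[of "\<lambda>\<omega>. \<omega>" "coord_filtration M F j t" "coord_filtration M F i s" A]
      sets.sets_into_space[OF that] that
    by (simp add: Int_absorb2)
  then show ?thesis by blast
qed

lemma coord_filtration_le_path_space:
  "sets (coord_filtration M F i t) \<subseteq> sets (path_space M)"
  unfolding coord_filtration_def
proof (rule sets_image_in_sets)
  have id: "(\<lambda>x. x) \<in> M \<rightarrow>\<^sub>M F t"
    using sets_F_le by (intro measurableI) (auto simp: space_F)
  show "(\<lambda>\<omega>. restrict \<omega> {1..i}) \<in> path_space M \<rightarrow>\<^sub>M PiM {1..i} (\<lambda>_. F t)"
    by (intro measurable_restrict measurable_compose[OF _ id] measurable_component_singleton) auto
qed simp

lemma filtration_coord: "filtration (space (path_space M)) (coord_filtration M F i)"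
  by unfold_locales (use coord_filtration_mono in auto)

lemma X_coord_adapted:
  assumes "1 \<le> k" "k \<le> i" "0 \<le> s" "ennreal s \<le> t"
  shows "(\<lambda>\<omega>. X s (\<omega> k)) \<in> coord_filtration M F i t \<rightarrow>\<^sub>M borel"
proof -
  have "X s \<in> F t \<rightarrow>\<^sub>M borel"
    using adapted[OF assms(3)] sets_F_mono[OF assms(4)]
    by (auto simp: measurable_def space_F)
  then show ?thesis
    using coord_filtration_measurable_comp assms(1,2) by blast
qed

lemma X_measurable: "0 \<le> t \<Longrightarrow> X t \<in> M \<rightarrow>\<^sub>M borel"
  using adapted[of t] sets_F_le[of "ennreal t"] by (auto simp: measurable_def space_F)

text \<open>At index \<open>0\<close>, outside the index set of the product, the path is a fixed default value.\<close>

lemma X_path_measurable: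
  assumes "0 \<le> t"
  shows "(\<lambda>\<omega>. X t (\<omega> k)) \<in> path_space M \<rightarrow>\<^sub>M borel"
proof (cases "1 \<le> k")
  case True
  then show ?thesis
    by (intro measurable_compose[OF _ X_measurable[OF assms]] measurable_component_singleton) auto
next
  case False
  then have "X t (\<omega> k) = X t undefined" if "\<omega> \<in> space (path_space M)" for \<omega>
    using that by (auto simp: space_PiM PiE_def extensional_def)
  then show ?thesis
    by (subst measurable_cong[where g="\<lambda>_. X t undefined"]) auto
qed

lemma X_P_measurable: "0 \<le> t \<Longrightarrow> X t \<in> P y \<rightarrow>\<^sub>M borel"
  using X_measurable sets_P[of y] by (simp cong: measurable_cong_sets)

definition transition_kernel :: "real \<Rightarrow> 'e \<Rightarrow> 'e measure" where
  "transition_kernel t x = distr (P x) borel (X t)"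

lemma emeasure_transition_kernel:
  assumes "0 \<le> t" "B \<in> sets borel"
  shows "emeasure (transition_kernel t x) B = ennreal (trans_prob P X t x B)"
proof -
  interpret prob_space "P x" by (rule prob_space_P)
  show ?thesis
    using X_P_measurable[OF assms(1), of x] assms(2) unfolding transition_kernel_def trans_prob_def
    by (auto simp: emeasure_distr emeasure_eq_measure vimage_def Int_def conj_commute)
qed

lemma prob_space_transition_kernel:
  assumes "0 \<le> t"
  shows "prob_space (transition_kernel t x)"
proof -
  interpret prob_space "P x" by (rule prob_space_P)
  show ?thesis
    unfolding transition_kernel_def by (rule prob_space_distr[OF X_P_measurable[OF assms(1)]])
qed

lemma transition_kernel_measurable:
  assumes "0 \<le> t"
  shows "transition_kernel t \<in> borel \<rightarrow>\<^sub>M subprob_algebra borel"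
proof (rule measurable_subprob_algebra)
  show "subprob_space (transition_kernel t x)" for x
    using prob_space_transition_kernel[OF assms] by (rule prob_space_imp_subprob_space)
  show "sets (transition_kernel t x) = sets borel" for x
    by (simp add: transition_kernel_def)
  show "(\<lambda>x. emeasure (transition_kernel t x) B) \<in> borel_measurable borel" if "B \<in> sets borel" for B
    using kernel[OF assms that] by (simp add: emeasure_transition_kernel[OF assms that])
qed

lemma transition_expectation_eq:
  fixes f :: "'e \<Rightarrow> real"
  assumes "0 \<le> t" "f \<in> borel_measurable borel"
  shows "(\<integral>u. f (X t u) \<partial>P y) = (\<integral>z. f z \<partial>transition_kernel t y)"
  unfolding transition_kernel_def
  by (rule integral_distr[symmetric, OF X_P_measurable[OF assms(1)] assms(2)])

lemma transition_expectation_measurable: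
  fixes f :: "'e \<Rightarrow> real"
  assumes "0 \<le> t" "f \<in> borel_measurable borel"
  shows "(\<lambda>y. \<integral>u. f (X t u) \<partial>P y) \<in> borel_measurable borel"
  unfolding transition_expectation_eq[OF assms]
  using measurable_compose[OF transition_kernel_measurable[OF assms(1)]
      integral_measurable_subprob_algebra[OF assms(2)]] .

lemma abs_transition_expectation_le:
  fixes f :: "'e \<Rightarrow> real"
  assumes "0 \<le> t" "f \<in> borel_measurable borel" and bound: "\<And>y. \<bar>f y\<bar> \<le> C"
  shows "\<bar>\<integral>u. f (X t u) \<partial>P y\<bar> \<le> C"
proof -
  interpret P: prob_space "P y" by (rule prob_space_P)
  have "integrable (P y) (\<lambda>u. f (X t u))"
    using bound
    by (intro P.integrable_const_bound[where B=C]
        measurable_compose[OF X_P_measurable[OF assms(1)] assms(2)]) auto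
  then have "(\<integral>u. \<bar>f (X t u)\<bar> \<partial>P y) \<le> (\<integral>u. C \<partial>P y)"
    using bound by (intro integral_mono) auto
  also have "\<dots> = C"
    by (simp add: P.prob_space)
  finally show ?thesis
    by (rule order_trans[OF integral_abs_bound])
qed

end

section \<open>Auxiliary estimates for series and integrals\<close>

text \<open>
  Evaluates a function of the unique index of the cell that contains \<open>\<omega>\<close>; the other cells
  contribute nothing.
\<close>

lemma suminf_indicator_partition:
  fixes f :: "nat \<Rightarrow> ennreal"
  assumes "\<omega> \<in> A j" "\<And>i. \<omega> \<in> A i \<Longrightarrow> i = j"
  shows "(\<Sum>i. indicator (A i) \<omega> * f i) = f j"
proof -
  have "indicator (A i) \<omega> * f i = 0" if "i \<noteq> j" for i
    using assms(2)[of i] that by (auto simp: indicator_def)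
  then have "(\<Sum>i. indicator (A i) \<omega> * f i) = (\<Sum>i\<in>{j}. indicator (A i) \<omega> * f i)"
    by (intro suminf_finite) auto
  then show ?thesis
    using assms(1) by simp
qed

text \<open>
  The nonnegative integral sees only the positive part of \<open>H\<close>, which can only increase the value.
\<close>

lemma ereal_integral_le_nn_integral:
  fixes H :: "'z \<Rightarrow> real"
  assumes "integrable N' H"
  shows "ereal (\<integral>\<omega>. H \<omega> \<partial>N') \<le> enn2ereal (\<integral>\<^sup>+\<omega>. ennreal (H \<omega>) \<partial>N')"
proof -
  have int: "integrable N' (\<lambda>\<omega>. max 0 (H \<omega>))"
    using assms by (intro integrable_max) auto
  then have eq: "(\<integral>\<^sup>+\<omega>. ennreal (max 0 (H \<omega>)) \<partial>N') = ennreal (\<integral>\<omega>. max 0 (H \<omega>) \<partial>N')"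
    by (intro nn_integral_eq_integral) auto
  have "(\<integral>\<omega>. H \<omega> \<partial>N') \<le> (\<integral>\<omega>. max 0 (H \<omega>) \<partial>N')"
    using assms int by (intro integral_mono) auto
  moreover have "0 \<le> (\<integral>\<omega>. max 0 (H \<omega>) \<partial>N')"
    by (intro Bochner_Integration.integral_nonneg) simp
  ultimately show ?thesis
    using eq by (simp add: ennreal_max_0)
qed

text \<open>
  After summation by parts the increments \<open>\<rho> (m + 1) - \<rho> m\<close> have constant sign, hence their total
  variation is \<open>\<rho> 0 - \<rho> n\<close> and the bound does not depend on \<open>n\<close>.
\<close>

lemma abel_summation_bound:
  fixes \<rho> a :: "nat \<Rightarrow> real"
  assumes \<rho>: "antimono \<rho>" "0 \<le> \<rho> n" and a: "\<And>m. \<bar>a m\<bar> \<le> W" and b: "\<bar>b\<bar> \<le> W"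
  shows "\<bar>(\<Sum>m<n. \<rho> m * (a m - a (Suc m))) + \<rho> n * (a n - b)\<bar> \<le> 2 * W * \<rho> 0"
proof -
  have "\<bar>(\<Sum>m<k. \<rho> m * (a m - a (Suc m))) + \<rho> k * a k - \<rho> 0 * a 0\<bar> \<le> W * (\<rho> 0 - \<rho> k)" for k
  proof (induction k)
    case (Suc k)
    have "\<bar>(\<rho> (Suc k) - \<rho> k) * a (Suc k)\<bar> \<le> (\<rho> k - \<rho> (Suc k)) * W"
      using a[of "Suc k"] antimonoD[OF \<rho>(1), of k "Suc k"]
      by (auto simp: abs_mult intro!: mult_mono)
    moreover have "(\<Sum>m<Suc k. \<rho> m * (a m - a (Suc m))) + \<rho> (Suc k) * a (Suc k) - \<rho> 0 * a 0 =
      ((\<Sum>m<k. \<rho> m * (a m - a (Suc m))) + \<rho> k * a k - \<rho> 0 * a 0) + (\<rho> (Suc k) - \<rho> k) * a (Suc k)"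
      by (simp add: algebra_simps)
    ultimately show ?case
      using Suc by (simp add: algebra_simps abs_le_iff)
  qed simp
  from this[of n] have 1: "\<bar>(\<Sum>m<n. \<rho> m * (a m - a (Suc m))) + \<rho> n * a n - \<rho> 0 * a 0\<bar> \<le> W * (\<rho> 0 - \<rho> n)" .
  have "0 \<le> \<rho> 0"
    using antimonoD[OF \<rho>(1), of 0 n] \<rho>(2) by simp
  then have 2: "\<bar>\<rho> 0 * a 0\<bar> \<le> W * \<rho> 0"
    using mult_left_mono[OF a[of 0], of "\<rho> 0"] by (simp add: abs_mult mult.commute)
  have 3: "\<bar>\<rho> n * b\<bar> \<le> W * \<rho> n"
    using mult_left_mono[OF b, of "\<rho> n"] \<rho>(2) by (simp add: abs_mult mult.commute)
  show ?thesis
    using 1 2 3 unfolding right_diff_distrib[of "\<rho> n"] right_diff_distrib[of W] by linarith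
qed

lemma suminf_const_ennreal:
  fixes a :: ennreal
  assumes "a \<noteq> 0"
  shows "(\<Sum>k::nat. a) = \<top>"
proof -
  have "(\<Sum>k::nat. a) = (\<integral>\<^sup>+k. a \<partial>count_space (UNIV :: nat set))"
    by (rule nn_integral_count_space_nat[symmetric])
  then show ?thesis
    using assms by (simp add: ennreal_mult_top)
qed

lemma bcontfun_measurable_bounded:
  fixes f :: "'e::{metric_space, second_countable_topology} \<Rightarrow> real"
  assumes "f \<in> bcontfun"
  obtains C where "f \<in> borel_measurable borel" "\<And>y. \<bar>f y\<bar> \<le> C"
proof -
  have "bounded (range f)"
    using assms by (simp add: bcontfun_def)
  then obtain C where "\<And>y. norm (f y) \<le> C"
    unfolding bounded_iff by auto
  moreover have "f \<in> borel_measurable borel"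
    using assms by (intro borel_measurable_continuous_onI) (simp add: bcontfun_def)
  ultimately show ?thesis
    using that by auto
qed

section \<open>Controlled processes observed on the time grid\<close>

text \<open>
  The process under the law \<open>N\<close>, started at \<open>x\<close> and controlled by a strategy on the grid
  \<open>{0, h, 2 h, \<dots>}\<close>.
\<close>

locale controlled_grid_process = standard_markov_process M F X P
  for M :: "'w measure" and F :: "ennreal \<Rightarrow> 'w measure"
    and X :: "real \<Rightarrow> 'w \<Rightarrow> 'e::{metric_space, second_countable_topology}"
    and P :: "'e \<Rightarrow> 'w measure" +
  fixes U :: "'e set" and h :: real
    and \<tau> :: "nat \<Rightarrow> (nat \<Rightarrow> 'w) \<Rightarrow> ennreal" and \<xi> :: "nat \<Rightarrow> (nat \<Rightarrow> 'w) \<Rightarrow> 'e"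
    and x :: 'e and N :: "(nat \<Rightarrow> 'w) measure"
  assumes h_pos: "0 < h"
    and strategy: "(\<tau>, \<xi>) \<in> grid_strategies M F U h"
    and law: "controlled_law M F X P x (\<tau>, \<xi>) N"
begin

sublocale N: prob_space N
  using law by (simp add: controlled_law_def)

lemma sets_N [measurable_cong]: "sets N = sets (path_space M)"
  using law by (simp add: controlled_law_def)

lemma space_N: "space N = space (path_space M)"
  using sets_N by (rule sets_eq_imp_space_eq)

lemma tau_0: "\<omega> \<in> space N \<Longrightarrow> \<tau> 0 \<omega> = 0"
  and tau_mono: "\<omega> \<in> space N \<Longrightarrow> i \<le> j \<Longrightarrow> \<tau> i \<omega> \<le> \<tau> j \<omega>"
  and tau_stopping: "1 \<le> i \<Longrightarrow> stopping_time (coord_filtration M F i) (\<tau> i)"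
  and xi_in_U: "\<omega> \<in> space N \<Longrightarrow> 1 \<le> i \<Longrightarrow> \<xi> i \<omega> \<in> U"
  using strategy by (auto simp: grid_strategies_def strategies_def space_N incseq_def)

lemma tau_grid:
  assumes "\<omega> \<in> space N" "\<tau> i \<omega> < \<top>"
  obtains n :: nat where "\<tau> i \<omega> = ennreal (real n * h)"
proof (cases "1 \<le> i")
  case True
  then have "\<tau> i \<omega> \<in> insert \<top> (range (\<lambda>n::nat. ennreal (real n * h)))"
    using assms(1) strategy unfolding grid_strategies_def space_N by blast
  then show ?thesis
    using assms(2) that by auto
next
  case False
  then show ?thesis
    using tau_0[OF assms(1)] that[of 0] by (cases i) auto
qed

lemma tau_le_coord:
  assumes "1 \<le> j" "i \<le> j" "s \<le> t"
  shows "{\<omega> \<in> space N. \<tau> i \<omega> \<le> s} \<in> sets (coord_filtration M F j t)"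
proof (cases "1 \<le> i")
  case True
  then show ?thesis
    using stopping_timeD[OF tau_stopping[OF True], of s] coord_filtration_mono[OF assms(2,3)]
    by (auto simp: pred_def space_N)
next
  case False
  then have "i = 0"
    by simp
  then have "{\<omega> \<in> space N. \<tau> i \<omega> \<le> s} = space (coord_filtration M F j t)"
    using tau_0 by (auto simp: space_N)
  then show ?thesis by (metis sets.top)
qed

lemma tau_measurable [measurable]: "\<tau> i \<in> borel_measurable N"
proof (rule borel_measurableI_le)
  show "{\<omega> \<in> space N. \<tau> i \<omega> \<le> t} \<in> sets N" for t
    using tau_le_coord[of "Suc i" i t t] coord_filtration_le_path_space sets_N by auto
qed

text \<open>
  At time \<open>n h\<close>, after the impulses of that time, the controlled process follows coordinate \<open>i\<close>.
\<close>

definition in_phase :: "nat \<Rightarrow> nat \<Rightarrow> (nat \<Rightarrow> 'w) \<Rightarrow> bool" where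
  "in_phase n i \<omega> \<longleftrightarrow> 1 \<le> i \<and> \<tau> (i - 1) \<omega> \<le> ennreal (real n * h) \<and> ennreal (real n * h) < \<tau> i \<omega>"

text \<open>
  Where no coordinate is active, because infinitely many impulses have accumulated, \<open>phase\<close> has the
  arbitrary value of \<open>THE\<close>. With this choice \<open>controlled_process\<close> agrees with \<open>post_state\<close> on every path.
\<close>

definition phase :: "nat \<Rightarrow> (nat \<Rightarrow> 'w) \<Rightarrow> nat" where
  "phase n \<omega> = (THE i. in_phase n i \<omega>)"

definition post_state :: "nat \<Rightarrow> (nat \<Rightarrow> 'w) \<Rightarrow> 'e" where
  "post_state n \<omega> = X (real n * h) (\<omega> (phase n \<omega>))"

text \<open>
  The coordinate that was active at time \<open>(n - 1) h\<close> is followed up to time \<open>n h\<close>; initially this is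
  coordinate \<open>1\<close>.
\<close>

definition pre_state :: "nat \<Rightarrow> (nat \<Rightarrow> 'w) \<Rightarrow> 'e" where
  "pre_state n \<omega> = X (real n * h) (\<omega> (case n of 0 \<Rightarrow> 1 | Suc m \<Rightarrow> phase m \<omega>))"

lemma controlled_process_grid: "controlled_process X \<tau> (real n * h) = post_state n"
  by (simp add: controlled_process_def post_state_def phase_def in_phase_def fun_eq_iff)

lemma in_phase_unique:
  assumes "\<omega> \<in> space N" "in_phase n i \<omega>" "in_phase n j \<omega>"
  shows "i = j"
proof -
  have False if "in_phase n i \<omega>" "in_phase n j \<omega>" "i < j" for i j
  proof -
    have "\<tau> i \<omega> \<le> \<tau> (j - 1) \<omega>"
      using that assms(1) by (intro tau_mono) auto
    then show False
      using that by (auto simp: in_phase_def)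
  qed
  then show ?thesis
    using assms by (meson linorder_neqE_nat)
qed

lemma phase_eqI: "\<omega> \<in> space N \<Longrightarrow> in_phase n i \<omega> \<Longrightarrow> phase n \<omega> = i"
  unfolding phase_def using in_phase_unique by blast

text \<open>
  Some impulse lies strictly after time \<open>n h\<close>, equivalently only finitely many impulses occur up to
  then.
\<close>

definition unfinished :: "nat \<Rightarrow> (nat \<Rightarrow> 'w) \<Rightarrow> bool" where
  "unfinished n \<omega> \<longleftrightarrow> (\<exists>k. ennreal (real n * h) < \<tau> k \<omega>)"

lemma in_phase_phase:
  assumes "\<omega> \<in> space N" "unfinished n \<omega>"
  shows "in_phase n (phase n \<omega>) \<omega>"
proof -
  define i where "i = (LEAST k. ennreal (real n * h) < \<tau> k \<omega>)"
  have 1: "ennreal (real n * h) < \<tau> i \<omega>"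
    using assms(2) unfolding unfinished_def i_def by (rule LeastI_ex)
  moreover have "1 \<le> i"
    using 1 tau_0[OF assms(1)] by (cases i) auto
  moreover have "\<not> ennreal (real n * h) < \<tau> (i - 1) \<omega>"
    using \<open>1 \<le> i\<close> by (intro not_less_Least) (auto simp: i_def[symmetric])
  ultimately have "in_phase n i \<omega>"
    by (auto simp: in_phase_def)
  then show ?thesis
    using phase_eqI[OF assms(1)] by metis
qed

lemma unfinished_antimono: "unfinished n \<omega> \<Longrightarrow> m \<le> n \<Longrightarrow> unfinished m \<omega>"
proof -
  assume "unfinished n \<omega>" "m \<le> n"
  moreover have "ennreal (real m * h) \<le> ennreal (real n * h)"
    using \<open>m \<le> n\<close> h_pos by (intro ennreal_leI mult_right_mono) auto
  ultimately show ?thesis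
    unfolding unfinished_def by (meson le_less_trans)
qed

lemma phase_measurable [measurable]: "phase n \<in> N \<rightarrow>\<^sub>M count_space UNIV"
  unfolding phase_def
proof (rule measurable_THE)
  show "Measurable.pred N (in_phase n i)" for i
    unfolding in_phase_def by measurable
qed (use in_phase_unique in auto)

lemma X_N_measurable: "0 \<le> t \<Longrightarrow> (\<lambda>\<omega>. X t (\<omega> k)) \<in> N \<rightarrow>\<^sub>M borel"
  using X_path_measurable sets_N by (simp cong: measurable_cong_sets)

lemma post_state_measurable [measurable]: "post_state n \<in> N \<rightarrow>\<^sub>M borel"
  unfolding post_state_def using h_pos
  by (intro measurable_compose_countable[OF X_N_measurable phase_measurable]) auto

lemma pre_state_measurable [measurable]: "pre_state n \<in> N \<rightarrow>\<^sub>M borel"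
proof (cases n)
  case 0
  then show ?thesis
    unfolding pre_state_def using X_N_measurable by auto
next
  case (Suc m)
  then show ?thesis
    unfolding pre_state_def using h_pos
    by (auto intro!: measurable_compose_countable[OF X_N_measurable phase_measurable])
qed

text \<open>
  Coordinate \<open>1\<close> is the only one not restarted by an impulse. Its Markov property under \<open>N\<close>
  is that of the uncontrolled process under \<open>P x\<close>, because events of the first coordinate are
  preimages of events of the original filtration and \<open>P x\<close> is the law of this coordinate.
\<close>

lemma markov_first:
  assumes A: "A \<in> sets (coord_filtration M F 1 (ennreal s))" and s: "0 \<le> s" "0 \<le> t" "B \<in> sets borel"
  shows "measure N {\<omega> \<in> A. X (s + t) (\<omega> 1) \<in> B} =
    (LINT \<omega>:A|N. trans_prob P X t (X s (\<omega> 1)) B)"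
proof -
  have first: "(\<lambda>\<omega>. \<omega> 1) \<in> N \<rightarrow>\<^sub>M M"
    by (simp add: measurable_component_singleton cong: measurable_cong_sets[OF sets_N refl])
  have distr: "distr N M (\<lambda>\<omega>. \<omega> 1) = P x"
    using law by (simp add: controlled_law_def)
  obtain A' where A': "A' \<in> sets (PiM {1..1::nat} (\<lambda>_. F (ennreal s)))"
    and A_eq: "A = (\<lambda>\<omega>. restrict \<omega> {1..1}) -` A' \<inter> space (path_space M)"
    using A unfolding coord_filtration_def
    by (subst (asm) sets_vimage_algebra2) (blast intro: restrict_in_space_PiM)+
  define A'' where "A'' = (\<lambda>u. \<lambda>i\<in>{1..1::nat}. u) -` A' \<inter> space M"
  have "(\<lambda>u. \<lambda>i\<in>{1..1::nat}. u) \<in> F (ennreal s) \<rightarrow>\<^sub>M PiM {1..1} (\<lambda>_. F (ennreal s))"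
    by (intro measurable_restrict) auto
  from measurable_sets[OF this A'] have A'': "A'' \<in> sets (F (ennreal s))"
    by (simp add: A''_def space_F)
  then have A''M: "A'' \<in> sets M"
    using sets_F_le by auto
  have "restrict \<omega> {1..1} = (\<lambda>i\<in>{1..1::nat}. \<omega> 1)" for \<omega> :: "nat \<Rightarrow> 'w"
    by (auto simp: fun_eq_iff)
  then have A_mem: "\<omega> \<in> A \<longleftrightarrow> \<omega> \<in> space N \<and> \<omega> 1 \<in> A''" for \<omega>
    unfolding A_eq A''_def using measurable_space[OF first] by (auto simp: space_N)
  have X[measurable]: "X (s + t) \<in> M \<rightarrow>\<^sub>M borel" "X s \<in> M \<rightarrow>\<^sub>M borel"
    using X_measurable s by auto
  have p[measurable]: "(\<lambda>y. trans_prob P X t y B) \<in> borel_measurable borel"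
    using kernel s by auto
  have "markov_at (trans_prob P X) (P x) F X (\<lambda>_. ennreal s)"
    by (rule strong_markov[OF stopping_time_const])
  then have "measure (P x) {u \<in> A''. X (s + t) u \<in> B} = (LINT u:A''|P x. trans_prob P X t (X s u) B)"
    using s A'' A''M sets_P sets_eq_imp_space_eq[OF sets_P, of x]
    by (intro markov_atD[where T="\<lambda>_. ennreal s" and F' = F])
       (auto simp: filtration_axioms)
  moreover have "measure (P x) {u \<in> A''. X (s + t) u \<in> B} = measure N {\<omega> \<in> A. X (s + t) (\<omega> 1) \<in> B}"
  proof -
    have "{u \<in> A''. X (s + t) u \<in> B} = A'' \<inter> (X (s + t) -` B \<inter> space M)"
      by (auto simp: A''_def)
    then have "{u \<in> A''. X (s + t) u \<in> B} \<in> sets M"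
      using A''M measurable_sets[OF X(1) s(3)] by auto
    then show ?thesis
      unfolding distr[symmetric] using first
      by (subst measure_distr) (auto simp: A_mem vimage_def Int_def conj_commute intro!: arg_cong[where f="measure N"])
  qed
  moreover have "(LINT u:A''|P x. trans_prob P X t (X s u) B) = (LINT \<omega>:A|N. trans_prob P X t (X s (\<omega> 1)) B)"
    unfolding distr[symmetric] set_lebesgue_integral_def using A''M first
    by (subst integral_distr) (auto simp: A_mem indicator_def intro!: Bochner_Integration.integral_cong)
  ultimately show ?thesis by simp
qed

text \<open>
  The Markov property of coordinate \<open>i + 1\<close> is available at the times \<open>\<tau> i + s\<close>. On an
  event where \<open>\<tau> i = m h\<close>, the choice \<open>s = (n - m) h\<close> turns it into the Markov property at time \<open>n h\<close>.
\<close>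

lemma markov_phase:
  assumes A: "A \<in> sets (coord_filtration M F (Suc i) (ennreal (real n * h)))"
    and T: "\<And>\<omega>. \<omega> \<in> A \<Longrightarrow> \<tau> i \<omega> = ennreal (real m * h)" and "m \<le> n" and B: "B \<in> sets borel"
  shows "measure N {\<omega> \<in> A. X (real (Suc n) * h) (\<omega> (Suc i)) \<in> B} =
    (LINT \<omega>:A|N. trans_prob P X h (X (real n * h) (\<omega> (Suc i))) B)"
proof (cases "i = 0")
  case True
  then show ?thesis
    using markov_first[of A "real n * h" h B] A B h_pos by (simp add: algebra_simps)
next
  case False
  have "0 \<le> real (n - m) * h"
    using h_pos by simp
  then have "markov_at (trans_prob P X) N (coord_filtration M F (i + 1)) (\<lambda>t \<omega>. X t (\<omega> (i + 1)))
      (\<lambda>\<omega>. \<tau> i \<omega> + ennreal (real (n - m) * h))"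
    using law False unfolding controlled_law_def by auto
  moreover have "\<tau> i \<omega> + ennreal (real (n - m) * h) = ennreal (real n * h)" if "\<omega> \<in> A" for \<omega>
    using T[OF that] h_pos \<open>m \<le> n\<close> by (simp add: of_nat_diff algebra_simps flip: ennreal_plus)
  moreover have "A \<in> sets N"
    using A coord_filtration_le_path_space sets_N by auto
  moreover have "filtration (space N) (coord_filtration M F (i + 1))"
    unfolding space_N by (rule filtration_coord)
  ultimately have "measure N {\<omega> \<in> A. X (real n * h + h) (\<omega> (i + 1)) \<in> B} =
      (LINT \<omega>:A|N. trans_prob P X h (X (real n * h) (\<omega> (i + 1))) B)"
    using A B h_pos
    by (intro markov_atD[where T="\<lambda>\<omega>. \<tau> i \<omega> + ennreal (real (n - m) * h)" and
          F'="coord_filtration M F (i + 1)"]) simp_all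
  then show ?thesis
    by (simp add: algebra_simps)
qed

section \<open>One step of the controlled process\<close>

lemma trans_prob_bounds: "0 \<le> trans_prob P X t y B" "trans_prob P X t y B \<le> 1"
  using prob_space.prob_le_1[OF prob_space_P] by (auto simp: trans_prob_def)

lemma nn_integral_markov_phase:
  assumes A: "A \<in> sets (coord_filtration M F (Suc i) (ennreal (real n * h)))"
    and T: "\<And>\<omega>. \<omega> \<in> A \<Longrightarrow> \<tau> i \<omega> = ennreal (real m * h)" and "m \<le> n" and B: "B \<in> sets borel"
  shows "(\<integral>\<^sup>+\<omega>. indicator A \<omega> * indicator B (X (real (Suc n) * h) (\<omega> (Suc i))) \<partial>N) =
    (\<integral>\<^sup>+\<omega>. indicator A \<omega> * emeasure (transition_kernel h (X (real n * h) (\<omega> (Suc i)))) B \<partial>N)"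
proof -
  have AN[measurable]: "A \<in> sets N"
    using A coord_filtration_le_path_space sets_N by auto
  have X[measurable]: "(\<lambda>\<omega>. X (real m * h) (\<omega> (Suc i))) \<in> N \<rightarrow>\<^sub>M borel" for m
    using X_N_measurable h_pos by simp
  have p[measurable]: "(\<lambda>y. trans_prob P X h y B) \<in> borel_measurable borel"
    using kernel h_pos B by simp
  have [measurable]: "B \<in> sets borel" by fact
  have "{\<omega> \<in> A. X (real (Suc n) * h) (\<omega> (Suc i)) \<in> B} =
      A \<inter> ((\<lambda>\<omega>. X (real (Suc n) * h) (\<omega> (Suc i))) -` B \<inter> space N)"
    using sets.sets_into_space[OF AN] by auto
  then have event: "{\<omega> \<in> A. X (real (Suc n) * h) (\<omega> (Suc i)) \<in> B} \<in> sets N"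
    using measurable_sets[OF X B, of "Suc n"] AN by auto
  have "(\<integral>\<^sup>+\<omega>. indicator A \<omega> * indicator B (X (real (Suc n) * h) (\<omega> (Suc i))) \<partial>N) =
      (\<integral>\<^sup>+\<omega>. indicator {\<omega> \<in> A. X (real (Suc n) * h) (\<omega> (Suc i)) \<in> B} \<omega> \<partial>N)"
    by (intro nn_integral_cong) (auto simp: indicator_def)
  also have "\<dots> = ennreal (measure N {\<omega> \<in> A. X (real (Suc n) * h) (\<omega> (Suc i)) \<in> B})"
    using event by (simp only: nn_integral_indicator N.emeasure_eq_measure)
  also have "\<dots> = ennreal (\<integral>\<omega>. indicator A \<omega> * trans_prob P X h (X (real n * h) (\<omega> (Suc i))) B \<partial>N)"
    by (simp only: markov_phase[OF A T \<open>m \<le> n\<close> B] set_lebesgue_integral_def real_scaleR_def)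
  also have "\<dots> = (\<integral>\<^sup>+\<omega>. ennreal (indicator A \<omega> * trans_prob P X h (X (real n * h) (\<omega> (Suc i))) B) \<partial>N)"
    using trans_prob_bounds
    by (intro nn_integral_eq_integral[symmetric] N.integrable_const_bound[where B=1])
       (auto simp: indicator_def)
  also have "\<dots> = (\<integral>\<^sup>+\<omega>. indicator A \<omega> * emeasure (transition_kernel h (X (real n * h) (\<omega> (Suc i)))) B \<partial>N)"
    using emeasure_transition_kernel[OF _ B, of h] h_pos
    by (intro nn_integral_cong) (auto simp: indicator_def)
  finally show ?thesis .
qed

text \<open>
  The space is partitioned, up to a null set, into the events that coordinate \<open>i + 1\<close> is active at
  time \<open>n h\<close> and was started at time \<open>m h\<close>. Each of them belongs to the \<open>\<sigma>\<close>-field at time \<open>n h\<close>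
  of the first \<open>i + 1\<close> coordinates, so the Markov property applies cell by cell.
\<close>

lemma distr_pre_state_Suc:
  assumes fin: "AE \<omega> in N. unfinished n \<omega>"
  shows "distr N borel (pre_state (Suc n)) = distr N borel (post_state n) \<bind> transition_kernel h"
proof (rule measure_eqI)
  have K[measurable]: "transition_kernel h \<in> borel \<rightarrow>\<^sub>M subprob_algebra borel"
    using transition_kernel_measurable h_pos by simp
  have K': "transition_kernel h \<in> distr N borel (post_state n) \<rightarrow>\<^sub>M subprob_algebra borel"
    using K by simp
  show "sets (distr N borel (pre_state (Suc n))) = sets (distr N borel (post_state n) \<bind> transition_kernel h)"
    by (simp add: sets_bind[of _ _ borel] transition_kernel_def)
  fix B assume "B \<in> sets (distr N borel (pre_state (Suc n)))"
  then have B[measurable]: "B \<in> sets borel" by simp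
  \<comment> \<open>The cells are numbered by an encoding of the pairs \<open>(i, m)\<close>; \<open>k j\<close> is the active coordinate on
    \<open>A j\<close>.\<close>
  define A where "A j = (case prod_decode j of (i, m) \<Rightarrow>
    {\<omega> \<in> space N. m \<le> n \<and> \<tau> i \<omega> = ennreal (real m * h) \<and> in_phase n (Suc i) \<omega>})" for j
  define k where "k j = Suc (fst (prod_decode j))" for j
  have A_coord: "A j \<in> sets (coord_filtration M F (k j) (ennreal (real n * h)))" for j
  proof -
    obtain i m where j: "prod_decode j = (i, m)" by force
    let ?G = "coord_filtration M F (Suc i) (ennreal (real n * h))"
    have le: "{\<omega> \<in> space ?G. \<tau> i' \<omega> \<le> ennreal t} \<in> sets ?G" if "i' \<le> Suc i" "t \<le> real n * h" for i' t
      using tau_le_coord[of "Suc i" i' "ennreal t" "ennreal (real n * h)"] that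
      by (simp add: space_N ennreal_leI)
    have eq: "{\<omega> \<in> space ?G. \<tau> i \<omega> = ennreal (real m * h)} \<in> sets ?G" if "m \<le> n"
    proof -
      have "{\<omega> \<in> space ?G. \<tau> i \<omega> = ennreal (real m * h)} =
        {\<omega> \<in> space ?G. \<tau> i \<omega> \<le> ennreal (real m * h)} -
        (\<Union>l<m. {\<omega> \<in> space ?G. \<tau> i \<omega> \<le> ennreal (real l * h)})"
        by (rule grid_time_eq_set[OF h_pos]) (metis space_coord_filtration space_N tau_grid)
      also have "\<dots> \<in> sets ?G"
        using that h_pos by (intro sets.Diff sets.finite_UN le) (auto intro!: mult_right_mono)
      finally show ?thesis .
    qed
    have "A j = (if m \<le> n then {\<omega> \<in> space ?G. \<tau> i \<omega> = ennreal (real m * h)} \<inter>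
        ({\<omega> \<in> space ?G. \<tau> i \<omega> \<le> ennreal (real n * h)} -
         {\<omega> \<in> space ?G. \<tau> (Suc i) \<omega> \<le> ennreal (real n * h)}) else {})"
      unfolding A_def j in_phase_def space_N by (auto simp: not_le)
    also have "\<dots> \<in> sets ?G"
    proof (cases "m \<le> n")
      case True
      then show ?thesis
        using eq[OF True] le[of i "real n * h"] le[of "Suc i" "real n * h"] by simp
    qed simp
    finally show ?thesis by (simp add: k_def j)
  qed
  then have A_N[measurable]: "A j \<in> sets N" for j
    using coord_filtration_le_path_space sets_N by blast
  have X[measurable]: "(\<lambda>\<omega>. X (real m * h) (\<omega> i)) \<in> N \<rightarrow>\<^sub>M borel" for m i
    using X_N_measurable h_pos by simp
  have k_phase: "k j = phase n \<omega>" if "\<omega> \<in> A j" for j \<omega>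
    using that phase_eqI[of \<omega> n] by (auto simp: A_def k_def split: prod.splits)
  have partition: "\<exists>j. \<omega> \<in> A j \<and> (\<forall>i. \<omega> \<in> A i \<longrightarrow> i = j)" if \<omega>: "\<omega> \<in> space N" and unf: "unfinished n \<omega>" for \<omega>
  proof -
    obtain i where i: "in_phase n (Suc i) \<omega>"
      using in_phase_phase[OF \<omega> unf] by (cases "phase n \<omega>") (auto simp: in_phase_def)
    then have le: "\<tau> i \<omega> \<le> ennreal (real n * h)"
      by (simp add: in_phase_def)
    then obtain m where m: "\<tau> i \<omega> = ennreal (real m * h)"
      using tau_grid[OF \<omega>, of i] by (metis ennreal_less_top le_less_trans)
    have "m \<le> n"
      using le m h_pos by (auto simp: ennreal_le_iff2 mult_le_0_iff)
    show ?thesis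
    proof (intro exI conjI allI impI)
      show "\<omega> \<in> A (prod_encode (i, m))"
        using i m \<omega> \<open>m \<le> n\<close> by (simp add: A_def)
      fix j assume j: "\<omega> \<in> A j"
      obtain i' m' where d: "prod_decode j = (i', m')" by force
      have "i' = i"
        using j in_phase_unique[OF \<omega> i] by (auto simp: A_def d)
      moreover have "m' = m"
        using j m h_pos \<open>i' = i\<close> by (auto simp: A_def d ennreal_inj)
      ultimately show "j = prod_encode (i, m)"
        using d by (metis prod_decode_inverse)
    qed
  qed
  have sum: "(\<Sum>j. indicator (A j) \<omega> * f (k j)) = f (phase n \<omega>)"
    if \<omega>: "\<omega> \<in> space N" "unfinished n \<omega>" for f :: "nat \<Rightarrow> ennreal" and \<omega>
  proof -
    obtain j where j: "\<omega> \<in> A j" "\<forall>i. \<omega> \<in> A i \<longrightarrow> i = j"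
      using partition[OF \<omega>] by blast
    have "(\<Sum>j. indicator (A j) \<omega> * f (k j)) = f (k j)"
      using suminf_indicator_partition[where A=A and f="\<lambda>j. f (k j)", OF j(1)] j(2) by blast
    then show ?thesis
      by (simp only: k_phase[OF j(1)])
  qed
  have "emeasure (distr N borel (pre_state (Suc n))) B = (\<integral>\<^sup>+y. indicator B y \<partial>distr N borel (pre_state (Suc n)))"
    by simp
  also have "\<dots> = (\<integral>\<^sup>+\<omega>. indicator B (pre_state (Suc n) \<omega>) \<partial>N)"
    by (rule nn_integral_distr) auto
  also have "\<dots> = (\<integral>\<^sup>+\<omega>. (\<Sum>j. indicator (A j) \<omega> * indicator B (X (real (Suc n) * h) (\<omega> (k j)))) \<partial>N)"
  proof (rule nn_integral_cong_AE, use fin AE_space in eventually_elim)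
    case (elim \<omega>)
    show ?case
      using sum[OF elim(2,1), of "\<lambda>i. indicator B (X (real (Suc n) * h) (\<omega> i))"]
      by (simp only: pre_state_def nat.case)
  qed
  also have "\<dots> = (\<Sum>j. \<integral>\<^sup>+\<omega>. indicator (A j) \<omega> * indicator B (X (real (Suc n) * h) (\<omega> (k j))) \<partial>N)"
    by (rule nn_integral_suminf) (simp del: of_nat_Suc)
  also have "\<dots> = (\<Sum>j. \<integral>\<^sup>+\<omega>. indicator (A j) \<omega> *
      emeasure (transition_kernel h (X (real n * h) (\<omega> (k j)))) B \<partial>N)"
  proof (rule suminf_cong)
    fix j
    obtain i m where j: "prod_decode j = (i, m)" by force
    show "(\<integral>\<^sup>+\<omega>. indicator (A j) \<omega> * indicator B (X (real (Suc n) * h) (\<omega> (k j))) \<partial>N) =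
      (\<integral>\<^sup>+\<omega>. indicator (A j) \<omega> * emeasure (transition_kernel h (X (real n * h) (\<omega> (k j)))) B \<partial>N)"
    proof (cases "m \<le> n")
      case True
      have kj: "k j = Suc i"
        by (simp add: k_def j)
      have "A j \<in> sets (coord_filtration M F (Suc i) (ennreal (real n * h)))"
        using A_coord[of j] by (simp only: kj)
      moreover have "\<tau> i \<omega> = ennreal (real m * h)" if "\<omega> \<in> A j" for \<omega>
        using that by (simp add: A_def j)
      ultimately show ?thesis
        unfolding kj using True B by (rule nn_integral_markov_phase)
    next
      case False
      then show ?thesis
        by (simp add: A_def j)
    qed
  qed
  also have "\<dots> = (\<integral>\<^sup>+\<omega>. (\<Sum>j. indicator (A j) \<omega> *
      emeasure (transition_kernel h (X (real n * h) (\<omega> (k j)))) B) \<partial>N)"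
    by (rule nn_integral_suminf[symmetric]) simp
  also have "\<dots> = (\<integral>\<^sup>+\<omega>. emeasure (transition_kernel h (post_state n \<omega>)) B \<partial>N)"
  proof (rule nn_integral_cong_AE, use fin AE_space in eventually_elim)
    case (elim \<omega>)
    show ?case
      using sum[OF elim(2,1), of "\<lambda>i. emeasure (transition_kernel h (X (real n * h) (\<omega> i))) B"]
      by (simp only: post_state_def)
  qed
  also have "\<dots> = (\<integral>\<^sup>+y. emeasure (transition_kernel h y) B \<partial>distr N borel (post_state n))"
    by (rule nn_integral_distr[symmetric]) auto
  also have "\<dots> = emeasure (distr N borel (post_state n) \<bind> transition_kernel h) B"
    by (rule emeasure_bind[symmetric, OF _ K']) auto
  finally show "emeasure (distr N borel (pre_state (Suc n))) B =
    emeasure (distr N borel (post_state n) \<bind> transition_kernel h) B" .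
qed

lemma expectation_pre_state_Suc:
  fixes f :: "'e \<Rightarrow> real"
  assumes fin: "AE \<omega> in N. unfinished n \<omega>" and f[measurable]: "f \<in> borel_measurable borel"
    and bounded: "\<And>y. \<bar>f y\<bar> \<le> C"
  shows "(\<integral>\<omega>. f (pre_state (Suc n) \<omega>) \<partial>N) = (\<integral>\<omega>. (\<integral>u. f (X h u) \<partial>P (post_state n \<omega>)) \<partial>N)"
proof -
  have h: "0 \<le> h"
    using h_pos by simp
  have K[measurable]: "transition_kernel h \<in> borel \<rightarrow>\<^sub>M subprob_algebra borel"
    by (rule transition_kernel_measurable[OF h])
  have "(\<integral>\<omega>. f (pre_state (Suc n) \<omega>) \<partial>N) = (\<integral>z. f z \<partial>distr N borel (pre_state (Suc n)))"
    by (rule integral_distr[symmetric]) auto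
  also have "\<dots> = (\<integral>y. (\<integral>z. f z \<partial>transition_kernel h y) \<partial>distr N borel (post_state n))"
    unfolding distr_pre_state_Suc[OF fin]
  proof (rule integral_bind[where K=borel and B=C and B'=1])
    show "finite_measure (distr N borel (post_state n))"
      by (rule prob_space.finite_measure[OF N.prob_space_distr]) simp
    show "AE y in distr N borel (post_state n). emeasure (transition_kernel h y) (space (transition_kernel h y)) \<le> ennreal 1"
      using prob_space.emeasure_space_1[OF prob_space_transition_kernel[OF h]] by auto
  qed (use bounded in auto)
  also have "\<dots> = (\<integral>\<omega>. (\<integral>u. f (X h u) \<partial>P (post_state n \<omega>)) \<partial>N)"
    using transition_expectation_measurable[OF h f]
    unfolding transition_expectation_eq[OF h f, symmetric] by (intro integral_distr) auto
  finally show ?thesis .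
qed

section \<open>Impulse costs along a path\<close>

abbreviation impulse_instant :: "nat \<Rightarrow> (nat \<Rightarrow> 'w) \<Rightarrow> real" where
  "impulse_instant i \<omega> \<equiv> enn2real (\<tau> i \<omega>)"

lemma tau_le_of_lt_phase:
  assumes "\<omega> \<in> space N" "unfinished n \<omega>" "i < phase n \<omega>"
  shows "\<tau> i \<omega> \<le> ennreal (real n * h)"
proof (rule order_trans)
  show "\<tau> i \<omega> \<le> \<tau> (phase n \<omega> - 1) \<omega>"
    using assms(3) by (intro tau_mono[OF assms(1)]) simp
  show "\<tau> (phase n \<omega> - 1) \<omega> \<le> ennreal (real n * h)"
    using in_phase_phase[OF assms(1,2)] by (simp add: in_phase_def)
qed

lemma tau_gt_of_ge_phase:
  assumes "\<omega> \<in> space N" "unfinished n \<omega>" "phase n \<omega> \<le> i"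
  shows "ennreal (real n * h) < \<tau> i \<omega>"
  using in_phase_phase[OF assms(1,2)] tau_mono[OF assms(1,3)]
  by (auto simp: in_phase_def intro: less_le_trans)

lemma tau_le_grid_cases:
  assumes "\<omega> \<in> space N" "\<tau> i \<omega> \<le> ennreal (real n * h)"
  obtains m where "m \<le> n" "\<tau> i \<omega> = ennreal (real m * h)"
proof -
  have "\<tau> i \<omega> < \<top>"
    using assms(2) by (rule le_less_trans) simp
  then obtain m where m: "\<tau> i \<omega> = ennreal (real m * h)"
    using tau_grid[OF assms(1)] by blast
  then have "m \<le> n"
    using assms(2) h_pos by (auto simp: ennreal_le_iff2 mult_le_0_iff)
  then show ?thesis using that m by blast
qed

definition prev_phase :: "nat \<Rightarrow> (nat \<Rightarrow> 'w) \<Rightarrow> nat" where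
  "prev_phase n \<omega> = (case n of 0 \<Rightarrow> 1 | Suc m \<Rightarrow> phase m \<omega>)"

lemma prev_phase_bounds:
  assumes "\<omega> \<in> space N" "unfinished n \<omega>"
  shows "1 \<le> prev_phase n \<omega>" "prev_phase n \<omega> \<le> phase n \<omega>"
proof -
  have 1: "1 \<le> phase n \<omega>"
    using in_phase_phase[OF assms] by (simp add: in_phase_def)
  have "1 \<le> phase m \<omega> \<and> phase m \<omega> \<le> phase n \<omega>" if n: "n = Suc m" for m
  proof -
    have unf: "unfinished m \<omega>"
      using unfinished_antimono[OF assms(2)] n by simp
    have "\<not> phase n \<omega> < phase m \<omega>"
    proof
      assume "phase n \<omega> < phase m \<omega>"
      from tau_le_of_lt_phase[OF assms(1) unf this] tau_gt_of_ge_phase[OF assms order_refl]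
      have "ennreal (real n * h) < ennreal (real m * h)"
        by (rule less_le_trans[rotated])
      then show False
        using n h_pos by (simp add: ennreal_less_iff)
    qed
    then show ?thesis
      using in_phase_phase[OF assms(1) unf] by (simp add: in_phase_def)
  qed
  then show "1 \<le> prev_phase n \<omega>" "prev_phase n \<omega> \<le> phase n \<omega>"
    using 1 by (auto simp: prev_phase_def split: nat.splits)
qed

text \<open>
  The impulse \<open>i\<close> happens not after \<open>n h\<close> and, if \<open>n > 0\<close>, after \<open>(n - 1) h\<close>; on the grid only \<open>n h\<close>
  is left.
\<close>

lemma tau_between_phases:
  assumes "\<omega> \<in> space N" "unfinished n \<omega>" "prev_phase n \<omega> \<le> i" "i < phase n \<omega>"
  shows "\<tau> i \<omega> = ennreal (real n * h)"
proof -
  obtain m where m: "m \<le> n" "\<tau> i \<omega> = ennreal (real m * h)"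
    using tau_le_grid_cases[OF assms(1) tau_le_of_lt_phase[OF assms(1,2,4)]] .
  have "m = n"
  proof (cases n)
    case (Suc n')
    then have "ennreal (real n' * h) < ennreal (real m * h)"
      using tau_gt_of_ge_phase[OF assms(1), of n' i] unfinished_antimono[OF assms(2), of n'] assms(3) m
      by (simp add: prev_phase_def)
    then show ?thesis
      using m(1) Suc h_pos by (simp add: ennreal_less_iff)
  qed (use m in simp)
  then show ?thesis using m by simp
qed

lemma pre_state_alt: "pre_state n \<omega> = X (real n * h) (\<omega> (prev_phase n \<omega>))"
  by (simp add: pre_state_def prev_phase_def)

text \<open>
  At time \<open>m h\<close> the impulses lead from coordinate \<open>prev_phase m\<close> to coordinate \<open>phase m\<close>, and the
  successive differences of \<open>w\<close> telescope. Grouping the impulses by their times turns a sum over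
  grid points into a sum over impulses, which has the shape of the impulse cost.
\<close>

lemma sum_jumps_eq_sum_impulses:
  fixes w :: "'e \<Rightarrow> real"
  assumes \<omega>: "\<omega> \<in> space N" "unfinished n \<omega>" and r: "\<And>m::nat. r (real m * h) = \<rho> m"
  shows "(\<Sum>m\<le>n. \<rho> m * (w (pre_state m \<omega>) - w (post_state m \<omega>))) =
    (\<Sum>k<phase n \<omega> - 1. let i = Suc k; s = impulse_instant i \<omega> in
      r s * (w (X s (\<omega> i)) - w (X s (\<omega> (i + 1)))))"
proof -
  define F where "F k = (let i = Suc k; s = impulse_instant i \<omega> in
      r s * (w (X s (\<omega> i)) - w (X s (\<omega> (i + 1)))))" for k
  have step: "sum F {..<phase m \<omega> - 1} =
      sum F {..<prev_phase m \<omega> - 1} + \<rho> m * (w (pre_state m \<omega>) - w (post_state m \<omega>))" if "m \<le> n" for m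
  proof -
    have unf: "unfinished m \<omega>"
      using unfinished_antimono[OF \<omega>(2) that] .
    note pb = prev_phase_bounds[OF \<omega>(1) unf]
    \<comment> \<open>The sign makes the telescoping sum run from the earlier to the later coordinate.\<close>
    define v where "v i = - w (X (real m * h) (\<omega> (Suc i)))" for i
    have F: "F k = \<rho> m * (v (Suc k) - v k)" if "k \<in> {prev_phase m \<omega> - 1..<phase m \<omega> - 1}" for k
    proof -
      have "\<tau> (Suc k) \<omega> = ennreal (real m * h)"
        using that pb by (intro tau_between_phases[OF \<omega>(1) unf]) auto
      then show ?thesis
        using h_pos r[of m] by (simp add: F_def v_def Let_def)
    qed
    have "sum F {..<phase m \<omega> - 1} = sum F {..<prev_phase m \<omega> - 1} + sum F {prev_phase m \<omega> - 1..<phase m \<omega> - 1}"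
      using pb by (simp add: sum.atLeastLessThan_concat atLeast0LessThan[symmetric])
    also have "sum F {prev_phase m \<omega> - 1..<phase m \<omega> - 1} =
        \<rho> m * (\<Sum>k\<in>{prev_phase m \<omega> - 1..<phase m \<omega> - 1}. v (Suc k) - v k)"
      unfolding sum_distrib_left using F by (intro sum.cong) auto
    also have "(\<Sum>k\<in>{prev_phase m \<omega> - 1..<phase m \<omega> - 1}. v (Suc k) - v k) =
        v (phase m \<omega> - 1) - v (prev_phase m \<omega> - 1)"
      using pb by (intro sum_Suc_diff') simp
    also have "\<dots> = w (pre_state m \<omega>) - w (post_state m \<omega>)"
      using pb by (simp add: v_def pre_state_alt post_state_def)
    finally show ?thesis .
  qed
  have "(\<Sum>m\<le>j. \<rho> m * (w (pre_state m \<omega>) - w (post_state m \<omega>))) = sum F {..<phase j \<omega> - 1}" if "j \<le> n" for j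
    using that
  proof (induction j)
    case 0
    then show ?case
      using step[of 0] by (simp add: prev_phase_def)
  next
    case (Suc j)
    then show ?case
      using step[of "Suc j"] by (simp add: prev_phase_def)
  qed
  then show ?thesis
    by (simp add: F_def)
qed

lemma impulse_cost_unfinished:
  assumes "\<omega> \<in> space N" "unfinished n \<omega>"
  shows "impulse_cost X c q \<tau> (ennreal (real n * h)) \<omega> =
    (\<Sum>k<phase n \<omega> - 1. let i = Suc k; s = impulse_instant i \<omega> in
      ennreal (q s * c (X s (\<omega> i)) (X s (\<omega> (i + 1)))))"
proof -
  have 1: "\<tau> (Suc k) \<omega> \<le> ennreal (real n * h)" if "k < phase n \<omega> - 1" for k
    using that by (intro tau_le_of_lt_phase[OF assms]) simp
  have 2: "\<not> \<tau> (Suc k) \<omega> \<le> ennreal (real n * h)" if "\<not> k < phase n \<omega> - 1" for k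
    using tau_gt_of_ge_phase[OF assms, of "Suc k"] that by (simp add: not_le)
  show ?thesis
    unfolding impulse_cost_def
    by (subst suminf_finite[of "{..<phase n \<omega> - 1}"]) (auto simp: Let_def 1 2 intro!: sum.cong)
qed

text \<open>
  Infinitely many impulses fall into a bounded time interval, on which the weights are bounded away
  from zero, as are the costs.
\<close>

lemma impulse_cost_finished:
  assumes \<omega>: "\<omega> \<in> space N" "\<not> unfinished n \<omega>" and e: "0 < e" "\<And>m. m \<le> n \<Longrightarrow> e \<le> q (real m * h)"
    and c: "0 < c\<^sub>0" "\<And>i. 1 \<le> i \<Longrightarrow> \<tau> i \<omega> < \<top> \<Longrightarrow>
      c\<^sub>0 \<le> c (X (impulse_instant i \<omega>) (\<omega> i)) (X (impulse_instant i \<omega>) (\<omega> (i + 1)))"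
  shows "impulse_cost X c q \<tau> (ennreal (real n * h)) \<omega> = \<top>"
proof -
  have "ennreal (e * c\<^sub>0) \<le> (let i = Suc k; s = impulse_instant i \<omega> in
      if \<tau> i \<omega> \<le> ennreal (real n * h) then ennreal (q s * c (X s (\<omega> i)) (X s (\<omega> (i + 1)))) else 0)" for k
  proof -
    have le: "\<tau> (Suc k) \<omega> \<le> ennreal (real n * h)"
      using \<omega>(2) by (simp add: unfinished_def not_less)
    then obtain m where m: "m \<le> n" "\<tau> (Suc k) \<omega> = ennreal (real m * h)"
      using tau_le_grid_cases[OF \<omega>(1)] by blast
    then have "e \<le> q (impulse_instant (Suc k) \<omega>)"
      using e(2)[of m] h_pos by simp
    moreover have "c\<^sub>0 \<le> c (X (impulse_instant (Suc k) \<omega>) (\<omega> (Suc k))) (X (impulse_instant (Suc k) \<omega>) (\<omega> (Suc k + 1)))"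
      using m by (intro c(2)) auto
    ultimately have "e * c\<^sub>0 \<le> q (impulse_instant (Suc k) \<omega>) *
        c (X (impulse_instant (Suc k) \<omega>) (\<omega> (Suc k))) (X (impulse_instant (Suc k) \<omega>) (\<omega> (Suc k + 1)))"
      using e(1) c(1) by (intro mult_mono) auto
    then show ?thesis
      using le by (simp add: Let_def ennreal_leI)
  qed
  then have "(\<Sum>k::nat. ennreal (e * c\<^sub>0)) \<le> impulse_cost X c q \<tau> (ennreal (real n * h)) \<omega>"
    unfolding impulse_cost_def by (intro suminf_le) auto
  moreover have "(\<Sum>k::nat. ennreal (e * c\<^sub>0)) = \<top>"
    using e(1) c(1) by (intro suminf_const_ennreal) (simp add: mult_pos_pos)
  ultimately show ?thesis
    by (simp add: top.extremum_unique)
qed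

lemma AE_after_impulse:
  "AE \<omega> in N. \<forall>i\<ge>1. \<tau> i \<omega> < \<top> \<longrightarrow> X (impulse_instant i \<omega>) (\<omega> (i + 1)) = \<xi> i \<omega>"
proof -
  have "AE \<omega> in N. 1 \<le> i \<longrightarrow> \<tau> i \<omega> < \<top> \<longrightarrow> X (impulse_instant i \<omega>) (\<omega> (i + 1)) = \<xi> i \<omega>" for i
    using law by (cases "1 \<le> i") (auto simp: controlled_law_def)
  then show ?thesis
    by (simp add: AE_all_countable)
qed

section \<open>Bounds for the expected total cost\<close>

text \<open>
  Common form of the two numerators: \<open>\<rho> i\<close> weights the running cost at time \<open>i h\<close> and \<open>q s\<close> the
  impulse cost at time \<open>s\<close>; in all uses the two are related by \<open>q (m h) = \<rho> m / h\<close>.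
\<close>

definition expected_total_cost ::
  "('e \<Rightarrow> real) \<Rightarrow> ('e \<Rightarrow> 'e \<Rightarrow> real) \<Rightarrow> (nat \<Rightarrow> real) \<Rightarrow> (real \<Rightarrow> real) \<Rightarrow> nat \<Rightarrow> ereal" where
  "expected_total_cost g c \<rho> q n =
    ereal (\<integral>\<omega>. (\<Sum>i<n. \<rho> i * g (post_state i \<omega>)) \<partial>N) +
    enn2ereal (\<integral>\<^sup>+\<omega>. impulse_cost X c q \<tau> (ennreal (real n * h)) \<omega> \<partial>N)"

lemma integrable_bounded_comp:
  fixes f :: "'e \<Rightarrow> real"
  assumes "f \<in> borel_measurable borel" "\<And>y. \<bar>f y\<bar> \<le> C" "Z \<in> N \<rightarrow>\<^sub>M borel"
  shows "integrable N (\<lambda>\<omega>. f (Z \<omega>))"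
  using assms by (intro N.integrable_const_bound[where B=C] measurable_compose[OF assms(3,1)]) auto

text \<open>
  The expected running costs and jumps of \<open>w\<close> are compared with the weighted gaps
  \<open>g + P\<^sub>h w - w\<close> in the Bellman equation. Replacing \<open>\<^bold>E (P\<^sub>h w) (Y\<^sub>m)\<close> by \<open>\<^bold>E w (Z\<^bsub>m+1\<^esub>)\<close> makes the
  expectations of \<open>w (Y\<^sub>m)\<close> cancel for \<open>m < n\<close>, and the rest is an Abel sum. Subsolutions bound
  the gaps from below, and an exact solution along the path determines them, so that this estimate
  serves both directions.
\<close>

lemma expected_jumps_estimate:
  fixes w g :: "'e \<Rightarrow> real"
  assumes fin: "AE \<omega> in N. unfinished n \<omega>"
    and w[measurable]: "w \<in> borel_measurable borel" and W: "\<And>y. \<bar>w y\<bar> \<le> W"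
    and g[measurable]: "g \<in> borel_measurable borel" and C: "\<And>y. \<bar>g y\<bar> \<le> C"
    and \<rho>: "antimono \<rho>" "0 \<le> \<rho> n"
  shows "\<bar>(\<integral>\<omega>. (\<Sum>i<n. \<rho> i * g (post_state i \<omega>)) \<partial>N) +
      (\<integral>\<omega>. (\<Sum>m\<le>n. \<rho> m * (w (pre_state m \<omega>) - w (post_state m \<omega>))) \<partial>N) -
      (\<Sum>m<n. \<rho> m * (\<integral>\<omega>. g (post_state m \<omega>) + (\<integral>u. w (X h u) \<partial>P (post_state m \<omega>)) - w (post_state m \<omega>) \<partial>N))\<bar>
    \<le> 2 * W * \<rho> 0"
proof -
  define a where "a m = (\<integral>\<omega>. w (pre_state m \<omega>) \<partial>N)" for m
  define b where "b m = (\<integral>\<omega>. w (post_state m \<omega>) \<partial>N)" for m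
  define d where "d m = (\<integral>\<omega>. g (post_state m \<omega>) \<partial>N)" for m
  note int_w = integrable_bounded_comp[OF w W] and int_g = integrable_bounded_comp[OF g C]
  have abs: "\<bar>\<integral>\<omega>. w (Z \<omega>) \<partial>N\<bar> \<le> W" if "Z \<in> N \<rightarrow>\<^sub>M borel" for Z
  proof -
    have "\<bar>\<integral>\<omega>. w (Z \<omega>) \<partial>N\<bar> \<le> (\<integral>\<omega>. \<bar>w (Z \<omega>)\<bar> \<partial>N)"
      by (rule integral_abs_bound)
    also have "\<dots> \<le> (\<integral>\<omega>. W \<partial>N)"
      using W int_w[OF that] by (intro integral_mono) auto
    finally show ?thesis by (simp add: N.prob_space)
  qed
  have step: "(\<integral>\<omega>. g (post_state m \<omega>) + (\<integral>u. w (X h u) \<partial>P (post_state m \<omega>)) - w (post_state m \<omega>) \<partial>N) =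
      d m + a (Suc m) - b m" if "m < n" for m
  proof -
    have fin_m: "AE \<omega> in N. unfinished m \<omega>"
      using fin unfinished_antimono that by (auto elim!: eventually_mono)
    have "integrable N (\<lambda>\<omega>. \<integral>u. w (X h u) \<partial>P (post_state m \<omega>))"
      using h_pos
      by (intro integrable_bounded_comp[OF transition_expectation_measurable[OF _ w]
            abs_transition_expectation_le[OF _ w W] post_state_measurable]) simp_all
    then show ?thesis
      using int_w[OF post_state_measurable[of m]] int_g[OF post_state_measurable[of m]]
      by (simp add: a_def b_def d_def expectation_pre_state_Suc[OF fin_m w W])
  qed
  have "(\<integral>\<omega>. (\<Sum>i<n. \<rho> i * g (post_state i \<omega>)) \<partial>N) = (\<Sum>i<n. \<rho> i * d i)"
    using int_g unfolding d_def by (subst Bochner_Integration.integral_sum) auto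
  moreover have "(\<integral>\<omega>. (\<Sum>m\<le>n. \<rho> m * (w (pre_state m \<omega>) - w (post_state m \<omega>))) \<partial>N) = (\<Sum>m\<le>n. \<rho> m * (a m - b m))"
    using int_w unfolding a_def b_def by (subst Bochner_Integration.integral_sum) auto
  moreover have "(\<Sum>m<n. \<rho> m * (\<integral>\<omega>. g (post_state m \<omega>) + (\<integral>u. w (X h u) \<partial>P (post_state m \<omega>)) - w (post_state m \<omega>) \<partial>N)) =
      (\<Sum>m<n. \<rho> m * (d m + a (Suc m) - b m))"
    using step by (intro sum.cong) auto
  moreover have "(\<Sum>i<n. \<rho> i * d i) + (\<Sum>m\<le>n. \<rho> m * (a m - b m)) - (\<Sum>m<n. \<rho> m * (d m + a (Suc m) - b m)) =
      (\<Sum>m<n. \<rho> m * (a m - a (Suc m))) + \<rho> n * (a n - b n)"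
    by (simp add: lessThan_Suc_atMost[symmetric] sum.distrib sum_subtractf algebra_simps)
  moreover have "\<bar>(\<Sum>m<n. \<rho> m * (a m - a (Suc m))) + \<rho> n * (a n - b n)\<bar> \<le> 2 * W * \<rho> 0"
    using abs by (intro abel_summation_bound \<rho>) (auto simp: a_def b_def)
  ultimately show ?thesis by metis
qed

lemma integrable_gap:
  fixes w g :: "'e \<Rightarrow> real"
  assumes w: "w \<in> borel_measurable borel" and W: "\<And>y. \<bar>w y\<bar> \<le> W"
    and g: "g \<in> borel_measurable borel" and C: "\<And>y. \<bar>g y\<bar> \<le> C"
  shows "integrable N (\<lambda>\<omega>. g (post_state m \<omega>) + (\<integral>u. w (X h u) \<partial>P (post_state m \<omega>)) - w (post_state m \<omega>))"
  using h_pos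
  by (intro Bochner_Integration.integrable_add Bochner_Integration.integrable_diff
      integrable_bounded_comp[OF transition_expectation_measurable[OF _ w]
        abs_transition_expectation_le[OF _ w W]]
      integrable_bounded_comp[OF w W] integrable_bounded_comp[OF g C] post_state_measurable) simp_all

text \<open>
  If almost every path has finitely many impulses up to time \<open>n h\<close>, then each impulse costs at least
  the drop of \<open>w\<close> that it causes and the gaps are at least \<open>lam\<close>. Otherwise the expected cost is
  infinite.
\<close>

lemma expected_total_cost_lower:
  fixes w g :: "'e \<Rightarrow> real"
  assumes w: "w \<in> borel_measurable borel" and W: "\<And>y. \<bar>w y\<bar> \<le> W"
    and g: "g \<in> borel_measurable borel" and C: "\<And>y. \<bar>g y\<bar> \<le> C"
    and \<rho>: "antimono \<rho>" "\<And>m. 0 < \<rho> m" and q: "\<And>m::nat. q (real m * h) = 1 / h * \<rho> m"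
    and sub: "\<And>y. w y \<le> g y - lam + (\<integral>u. w (X h u) \<partial>P y)"
    and jump: "\<And>y \<eta>. \<eta> \<in> U \<Longrightarrow> w y \<le> 1 / h * c y \<eta> + w \<eta>"
    and c: "0 < c\<^sub>0" "\<And>y \<eta>. \<eta> \<in> U \<Longrightarrow> c\<^sub>0 \<le> c y \<eta>"
  shows "ereal (lam * (\<Sum>i<n. \<rho> i) - 2 * W * \<rho> 0) \<le> expected_total_cost g c \<rho> q n"
proof (cases "AE \<omega> in N. unfinished n \<omega>")
  case fin: True
  define H where "H \<omega> = (\<Sum>m\<le>n. \<rho> m * (w (pre_state m \<omega>) - w (post_state m \<omega>)))" for \<omega>
  have int_H: "integrable N H"
    unfolding H_def using integrable_bounded_comp[OF w W]
    by (intro Bochner_Integration.integrable_sum integrable_mult_right Bochner_Integration.integrable_diff) auto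
  have "AE \<omega> in N. ennreal (H \<omega>) \<le> impulse_cost X c q \<tau> (ennreal (real n * h)) \<omega>"
    using fin AE_space AE_after_impulse
  proof eventually_elim
    case (elim \<omega>)
    let ?s = "\<lambda>k. impulse_instant (Suc k) \<omega>"
    let ?c = "\<lambda>k. q (?s k) * c (X (?s k) (\<omega> (Suc k))) (X (?s k) (\<omega> (Suc k + 1)))"
    let ?w = "\<lambda>k. (h * q (?s k)) * (w (X (?s k) (\<omega> (Suc k))) - w (X (?s k) (\<omega> (Suc k + 1))))"
    have summand: "?w k \<le> ?c k \<and> 0 \<le> ?c k" if "k < phase n \<omega> - 1" for k
    proof -
      have "\<tau> (Suc k) \<omega> \<le> ennreal (real n * h)"
        using that by (intro tau_le_of_lt_phase[OF elim(2,1)]) simp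
      then obtain m where m: "\<tau> (Suc k) \<omega> = ennreal (real m * h)"
        using tau_le_grid_cases[OF elim(2)] by blast
      then have "?s k = real m * h"
        using h_pos by simp
      then have q_pos: "0 < q (?s k)"
        using q[of m] \<rho>(2)[of m] h_pos by simp
      have "X (?s k) (\<omega> (Suc k + 1)) = \<xi> (Suc k) \<omega>"
        using elim(3)[rule_format, of "Suc k"] m by simp
      then have in_U: "X (?s k) (\<omega> (Suc k + 1)) \<in> U"
        using xi_in_U[OF elim(2), of "Suc k"] by simp
      have "(h * q (?s k)) * (w (X (?s k) (\<omega> (Suc k))) - w (X (?s k) (\<omega> (Suc k + 1)))) \<le>
          (h * q (?s k)) * (1 / h * c (X (?s k) (\<omega> (Suc k))) (X (?s k) (\<omega> (Suc k + 1))))"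
        using jump[OF in_U, of "X (?s k) (\<omega> (Suc k))"] q_pos h_pos by (intro mult_left_mono) auto
      also have "\<dots> = ?c k"
        using h_pos by simp
      finally show ?thesis
        using c(2)[OF in_U, of "X (?s k) (\<omega> (Suc k))"] c(1) q_pos by simp
    qed
    have "H \<omega> = (\<Sum>k<phase n \<omega> - 1. ?w k)"
      using sum_jumps_eq_sum_impulses[OF elim(2,1), where r="\<lambda>s. h * q s" and \<rho>=\<rho> and w=w] q h_pos
      by (simp add: H_def Let_def)
    also have "\<dots> \<le> (\<Sum>k<phase n \<omega> - 1. ?c k)"
      using summand by (intro sum_mono) auto
    finally have "ennreal (H \<omega>) \<le> ennreal (\<Sum>k<phase n \<omega> - 1. ?c k)"
      by (rule ennreal_leI)
    also have "\<dots> = (\<Sum>k<phase n \<omega> - 1. ennreal (?c k))"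
      using summand by (intro sum_ennreal[symmetric]) auto
    also have "\<dots> = impulse_cost X c q \<tau> (ennreal (real n * h)) \<omega>"
      unfolding impulse_cost_unfinished[OF elim(2,1)] by (simp add: Let_def)
    finally show ?case .
  qed
  then have "(\<integral>\<^sup>+\<omega>. ennreal (H \<omega>) \<partial>N) \<le> (\<integral>\<^sup>+\<omega>. impulse_cost X c q \<tau> (ennreal (real n * h)) \<omega> \<partial>N)"
    by (rule nn_integral_mono_AE)
  then have H_le: "ereal (\<integral>\<omega>. H \<omega> \<partial>N) \<le> enn2ereal (\<integral>\<^sup>+\<omega>. impulse_cost X c q \<tau> (ennreal (real n * h)) \<omega> \<partial>N)"
    using ereal_integral_le_nn_integral[OF int_H] by (simp add: less_eq_ennreal.rep_eq)
  let ?gap = "\<lambda>m. \<integral>\<omega>. g (post_state m \<omega>) + (\<integral>u. w (X h u) \<partial>P (post_state m \<omega>)) - w (post_state m \<omega>) \<partial>N"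
  have "lam \<le> ?gap m" for m
  proof -
    have "(\<integral>\<omega>. lam \<partial>N) \<le> ?gap m"
      using sub integrable_gap[OF w W g C] by (intro integral_mono) (auto simp: algebra_simps)
    then show ?thesis by (simp add: N.prob_space)
  qed
  then have "lam * (\<Sum>i<n. \<rho> i) \<le> (\<Sum>m<n. \<rho> m * ?gap m)"
    unfolding sum_distrib_left using \<rho>(2) by (intro sum_mono) (simp add: mult.commute[of lam])
  moreover have "\<bar>(\<integral>\<omega>. (\<Sum>i<n. \<rho> i * g (post_state i \<omega>)) \<partial>N) + (\<integral>\<omega>. H \<omega> \<partial>N) - (\<Sum>m<n. \<rho> m * ?gap m)\<bar> \<le> 2 * W * \<rho> 0"
    unfolding H_def using \<rho>(2)[of n] by (intro expected_jumps_estimate[OF fin w W g C \<rho>(1)]) simp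
  ultimately have "lam * (\<Sum>i<n. \<rho> i) - 2 * W * \<rho> 0 \<le>
      (\<integral>\<omega>. (\<Sum>i<n. \<rho> i * g (post_state i \<omega>)) \<partial>N) + (\<integral>\<omega>. H \<omega> \<partial>N)"
    by linarith
  then have "ereal (lam * (\<Sum>i<n. \<rho> i) - 2 * W * \<rho> 0) \<le>
      ereal (\<integral>\<omega>. (\<Sum>i<n. \<rho> i * g (post_state i \<omega>)) \<partial>N) + ereal (\<integral>\<omega>. H \<omega> \<partial>N)"
    by simp
  also have "\<dots> \<le> expected_total_cost g c \<rho> q n"
    unfolding expected_total_cost_def using H_le by (intro add_left_mono)
  finally show ?thesis .
next
  case False
  define Bad where "Bad = {\<omega> \<in> space N. \<not> unfinished n \<omega>}"
  have Bad[measurable]: "Bad \<in> sets N"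
    unfolding Bad_def unfinished_def by measurable
  have pos: "emeasure N Bad \<noteq> 0"
    using False Bad by (subst (asm) AE_iff_measurable[OF Bad]) (auto simp: Bad_def)
  have "AE \<omega> in N. \<top> * indicator Bad \<omega> \<le> impulse_cost X c q \<tau> (ennreal (real n * h)) \<omega>"
    using AE_space AE_after_impulse
  proof eventually_elim
    case (elim \<omega>)
    have "impulse_cost X c q \<tau> (ennreal (real n * h)) \<omega> = \<top>" if "\<omega> \<in> Bad"
    proof (rule impulse_cost_finished)
      show "0 < 1 / h * \<rho> n"
        using h_pos \<rho>(2) by simp
      show "1 / h * \<rho> n \<le> q (real m * h)" if "m \<le> n" for m
        unfolding q using h_pos antimonoD[OF \<rho>(1) that] by (intro mult_left_mono) auto
      show "c\<^sub>0 \<le> c (X (impulse_instant i \<omega>) (\<omega> i)) (X (impulse_instant i \<omega>) (\<omega> (i + 1)))"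
        if "1 \<le> i" "\<tau> i \<omega> < \<top>" for i
        using elim(2) that xi_in_U[OF elim(1) that(1)] by (intro c(2)) simp
    qed (use that elim c in \<open>auto simp: Bad_def\<close>)
    then show ?case
      by (auto simp: indicator_def)
  qed
  then have "(\<integral>\<^sup>+\<omega>. \<top> * indicator Bad \<omega> \<partial>N) \<le> (\<integral>\<^sup>+\<omega>. impulse_cost X c q \<tau> (ennreal (real n * h)) \<omega> \<partial>N)"
    by (rule nn_integral_mono_AE)
  moreover have "(\<integral>\<^sup>+\<omega>. \<top> * indicator Bad \<omega> \<partial>N) = \<top>"
    using pos by (subst nn_integral_cmult_indicator) (auto simp: ennreal_top_mult)
  ultimately have "(\<integral>\<^sup>+\<omega>. impulse_cost X c q \<tau> (ennreal (real n * h)) \<omega> \<partial>N) = \<top>"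
    by (simp add: top.extremum_unique)
  then show ?thesis
    by (simp add: expected_total_cost_def)
qed

text \<open>
  Converse of the previous bound when the Bellman equation holds with equality along the path:
  \<open>wait\<close> between the impulses and \<open>jump\<close> at them.
\<close>

lemma expected_total_cost_upper:
  fixes w g :: "'e \<Rightarrow> real"
  assumes fin: "AE \<omega> in N. unfinished n \<omega>"
    and w: "w \<in> borel_measurable borel" and W: "\<And>y. \<bar>w y\<bar> \<le> W"
    and g: "g \<in> borel_measurable borel" and C: "\<And>y. \<bar>g y\<bar> \<le> C"
    and \<rho>: "antimono \<rho>" "\<And>m. 0 < \<rho> m" and q: "\<And>m::nat. q (real m * h) = 1 / h * \<rho> m"
    and wait: "AE \<omega> in N. \<forall>m<n. w (post_state m \<omega>) =
      g (post_state m \<omega>) - lam + (\<integral>u. w (X h u) \<partial>P (post_state m \<omega>))"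
    and jump: "AE \<omega> in N. \<forall>i\<ge>1. \<tau> i \<omega> < \<top> \<longrightarrow>
      (let s = impulse_instant i \<omega>; y = X s (\<omega> i); y' = X s (\<omega> (i + 1)) in
        0 \<le> c y y' \<and> w y = 1 / h * c y y' + w y')"
  shows "expected_total_cost g c \<rho> q n \<le> ereal (lam * (\<Sum>i<n. \<rho> i) + 2 * W * \<rho> 0)"
proof -
  define H where "H \<omega> = (\<Sum>m\<le>n. \<rho> m * (w (pre_state m \<omega>) - w (post_state m \<omega>)))" for \<omega>
  have int_H: "integrable N H"
    unfolding H_def using integrable_bounded_comp[OF w W]
    by (intro Bochner_Integration.integrable_sum integrable_mult_right Bochner_Integration.integrable_diff) auto
  have AE_H: "AE \<omega> in N. 0 \<le> H \<omega> \<and> impulse_cost X c q \<tau> (ennreal (real n * h)) \<omega> = ennreal (H \<omega>)"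
    using fin AE_space jump
  proof eventually_elim
    case (elim \<omega>)
    let ?s = "\<lambda>k. impulse_instant (Suc k) \<omega>"
    let ?c = "\<lambda>k. q (?s k) * c (X (?s k) (\<omega> (Suc k))) (X (?s k) (\<omega> (Suc k + 1)))"
    let ?w = "\<lambda>k. (h * q (?s k)) * (w (X (?s k) (\<omega> (Suc k))) - w (X (?s k) (\<omega> (Suc k + 1))))"
    have summand: "?w k = ?c k \<and> 0 \<le> ?c k" if "k < phase n \<omega> - 1" for k
    proof -
      have "\<tau> (Suc k) \<omega> \<le> ennreal (real n * h)"
        using that by (intro tau_le_of_lt_phase[OF elim(2,1)]) simp
      then obtain m where m: "\<tau> (Suc k) \<omega> = ennreal (real m * h)"
        using tau_le_grid_cases[OF elim(2)] by blast
      then have "?s k = real m * h"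
        using h_pos by simp
      then have q_pos: "0 < q (?s k)"
        using q[of m] \<rho>(2)[of m] h_pos by simp
      have "\<tau> (Suc k) \<omega> < \<top>"
        using m by simp
      then have "0 \<le> c (X (?s k) (\<omega> (Suc k))) (X (?s k) (\<omega> (Suc k + 1)))"
        "w (X (?s k) (\<omega> (Suc k))) = 1 / h * c (X (?s k) (\<omega> (Suc k))) (X (?s k) (\<omega> (Suc k + 1)))
          + w (X (?s k) (\<omega> (Suc k + 1)))"
        using elim(3)[rule_format, of "Suc k"] by (simp_all add: Let_def)
      then show ?thesis
        using q_pos h_pos by simp
    qed
    have "H \<omega> = (\<Sum>k<phase n \<omega> - 1. ?w k)"
      using sum_jumps_eq_sum_impulses[OF elim(2,1), where r="\<lambda>s. h * q s" and \<rho>=\<rho> and w=w] q h_pos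
      by (simp add: H_def Let_def)
    also have "\<dots> = (\<Sum>k<phase n \<omega> - 1. ?c k)"
      using summand by (intro sum.cong) auto
    finally have H: "H \<omega> = (\<Sum>k<phase n \<omega> - 1. ?c k)" .
    then have "ennreal (H \<omega>) = (\<Sum>k<phase n \<omega> - 1. ennreal (?c k))"
      using summand by (auto intro!: sum_ennreal[symmetric])
    also have "\<dots> = impulse_cost X c q \<tau> (ennreal (real n * h)) \<omega>"
      unfolding impulse_cost_unfinished[OF elim(2,1)] by (simp add: Let_def)
    finally show ?case
      using H summand by (auto intro!: sum_nonneg)
  qed
  have "(\<integral>\<^sup>+\<omega>. impulse_cost X c q \<tau> (ennreal (real n * h)) \<omega> \<partial>N) = (\<integral>\<^sup>+\<omega>. ennreal (H \<omega>) \<partial>N)"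
    using AE_H by (intro nn_integral_cong_AE) (auto elim: eventually_mono)
  also have "\<dots> = ennreal (\<integral>\<omega>. H \<omega> \<partial>N)"
    using AE_H by (intro nn_integral_eq_integral int_H) (auto elim: eventually_mono)
  finally have "enn2ereal (\<integral>\<^sup>+\<omega>. impulse_cost X c q \<tau> (ennreal (real n * h)) \<omega> \<partial>N) = ereal (\<integral>\<omega>. H \<omega> \<partial>N)"
    using AE_H by (simp add: integral_nonneg_AE eventually_mono)
  then have total: "expected_total_cost g c \<rho> q n =
      ereal ((\<integral>\<omega>. (\<Sum>i<n. \<rho> i * g (post_state i \<omega>)) \<partial>N) + (\<integral>\<omega>. H \<omega> \<partial>N))"
    by (simp add: expected_total_cost_def)
  let ?gap = "\<lambda>m. \<integral>\<omega>. g (post_state m \<omega>) + (\<integral>u. w (X h u) \<partial>P (post_state m \<omega>)) - w (post_state m \<omega>) \<partial>N"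
  have "?gap m = lam" if "m < n" for m
  proof -
    have "?gap m = (\<integral>\<omega>. lam \<partial>N)"
    proof (rule integral_cong_AE)
      show "AE \<omega> in N. g (post_state m \<omega>) + (\<integral>u. w (X h u) \<partial>P (post_state m \<omega>)) - w (post_state m \<omega>) = lam"
        using wait by eventually_elim (use that in auto)
    qed (use integrable_gap[OF w W g C] in auto)
    then show ?thesis by (simp add: N.prob_space)
  qed
  then have "(\<Sum>m<n. \<rho> m * ?gap m) = lam * (\<Sum>i<n. \<rho> i)"
    unfolding sum_distrib_left by (intro sum.cong) auto
  moreover have "\<bar>(\<integral>\<omega>. (\<Sum>i<n. \<rho> i * g (post_state i \<omega>)) \<partial>N) + (\<integral>\<omega>. H \<omega> \<partial>N) - (\<Sum>m<n. \<rho> m * ?gap m)\<bar> \<le> 2 * W * \<rho> 0"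
    unfolding H_def using \<rho>(2)[of n] by (intro expected_jumps_estimate[OF fin w W g C \<rho>(1)]) simp
  ultimately show ?thesis
    unfolding total by simp
qed

text \<open>
  Infinitely many impulses up to time \<open>n h\<close> would have to accumulate at a single grid point, and
  there each of them would lower the bounded function \<open>w\<close> by at least \<open>\<delta>\<close>.
\<close>

lemma AE_unfinished:
  fixes w :: "'e \<Rightarrow> real"
  assumes W: "\<And>y. \<bar>w y\<bar> \<le> W" and \<delta>: "0 < \<delta>"
    and jump: "AE \<omega> in N. \<forall>i\<ge>1. \<tau> i \<omega> < \<top> \<longrightarrow>
      \<delta> + w (X (impulse_instant i \<omega>) (\<omega> (i + 1))) \<le> w (X (impulse_instant i \<omega>) (\<omega> i))"
  shows "AE \<omega> in N. unfinished n \<omega>"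
  using jump AE_space
proof eventually_elim
  case (elim \<omega>)
  show ?case
  proof (rule ccontr)
    assume "\<not> unfinished n \<omega>"
    then have le: "\<tau> k \<omega> \<le> ennreal (real n * h)" for k
      by (simp add: unfinished_def not_less)
    define S where "S = {m. m \<le> n \<and> (\<exists>k\<ge>1. \<tau> k \<omega> = ennreal (real m * h))}"
    have S_ex: "\<exists>m\<in>S. \<tau> k \<omega> = ennreal (real m * h)" if "1 \<le> k" for k
    proof -
      obtain m where "m \<le> n" "\<tau> k \<omega> = ennreal (real m * h)"
        using tau_le_grid_cases[OF elim(2) le[of k]] .
      then show ?thesis
        using that by (intro bexI[of _ m]) (auto simp: S_def)
    qed
    have fin_S: "finite S"
      unfolding S_def by simp
    have "S \<noteq> {}"
      using S_ex[of 1] by auto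
    then have "Max S \<in> S"
      by (rule Max_in[OF fin_S])
    \<comment> \<open>From impulse \<open>K\<close> on, all impulse times equal the largest grid point that is ever used.\<close>
    then obtain K where K: "1 \<le> K" "\<tau> K \<omega> = ennreal (real (Max S) * h)"
      unfolding S_def by auto
    let ?s = "real (Max S) * h"
    have const: "\<tau> k \<omega> = ennreal ?s" if "K \<le> k" for k
    proof -
      have "1 \<le> k"
        using K(1) that by simp
      then obtain m where m: "m \<in> S" "\<tau> k \<omega> = ennreal (real m * h)"
        using S_ex by blast
      then have "\<tau> k \<omega> \<le> ennreal ?s"
        using Max_ge[OF fin_S m(1)] h_pos by (auto intro!: ennreal_leI mult_right_mono)
      then show ?thesis
        using tau_mono[OF elim(2) that] K by simp
    qed
    have step: "\<delta> + w (X ?s (\<omega> (Suc k))) \<le> w (X ?s (\<omega> k))" if "K \<le> k" for k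
      using elim(1)[rule_format, of k] const[OF that] K(1) that h_pos by simp
    have "real j * \<delta> + w (X ?s (\<omega> (K + j))) \<le> w (X ?s (\<omega> K))" for j
    proof (induction j)
      case (Suc j)
      then show ?case
        using step[of "K + j"] by (simp add: algebra_simps)
    qed simp
    then have "real j * \<delta> \<le> 2 * W" for j
      using W[of "X ?s (\<omega> K)"] W[of "X ?s (\<omega> (K + j))"] by (smt (verit))
    moreover obtain j :: nat where "2 * W < real j * \<delta>"
      using reals_Archimedean3[OF \<delta>] by blast
    ultimately show False
      by (meson not_le)
  qed
qed

lemma J_disc_eq:
  assumes "V = (\<tau>, \<xi>)" "PV x V = N"
  shows "J_disc X g c \<beta> PV h x V = limsup (\<lambda>n.
    expected_total_cost g c (\<lambda>i. phi \<beta> h (real i)) (\<lambda>s. 1 / h * phi \<beta> h (s / h)) n /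
    ereal (\<Sum>i<n. phi \<beta> h (real i)))"
  unfolding J_disc_def expected_total_cost_def assms(2) unfolding assms(1) by (simp add: controlled_process_grid)

text \<open>
  Unlike in \<open>expected_total_cost\<close>, the running cost is summed over the times \<open>h, \<dots>, n h\<close>.
\<close>

definition expected_avg_cost :: "('e \<Rightarrow> real) \<Rightarrow> ('e \<Rightarrow> 'e \<Rightarrow> real) \<Rightarrow> nat \<Rightarrow> ereal" where
  "expected_avg_cost g c n =
    ereal (\<integral>\<omega>. (\<Sum>i=1..n. g (post_state i \<omega>)) \<partial>N) +
    enn2ereal (\<integral>\<^sup>+\<omega>. impulse_cost X c (\<lambda>s. 1 / h) \<tau> (ennreal (real n * h)) \<omega> \<partial>N)"

lemma J_avg_eq:
  assumes "V = (\<tau>, \<xi>)" "PV x V = N"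
  shows "J_avg X g c PV h x V = limsup (\<lambda>n. expected_avg_cost g c n / ereal (real n))"
  unfolding J_avg_def expected_avg_cost_def assms(2) unfolding assms(1) by (simp add: controlled_process_grid)

text \<open>
  Shifting the summation range exchanges one bounded term for another.
\<close>

lemma expected_avg_cost_bounds:
  fixes g :: "'e \<Rightarrow> real"
  assumes g: "g \<in> borel_measurable borel" and C: "\<And>y. \<bar>g y\<bar> \<le> C"
  shows "expected_avg_cost g c n \<le> expected_total_cost g c (\<lambda>_. 1) (\<lambda>s. 1 / h) n + ereal (2 * C)"
    and "expected_total_cost g c (\<lambda>_. 1) (\<lambda>s. 1 / h) n \<le> expected_avg_cost g c n + ereal (2 * C)"
proof -
  note int = integrable_bounded_comp[OF g C post_state_measurable]
  define A where "A = (\<integral>\<omega>. (\<Sum>i=1..n. g (post_state i \<omega>)) \<partial>N)"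
  define B where "B = (\<integral>\<omega>. (\<Sum>i<n. 1 * g (post_state i \<omega>)) \<partial>N)"
  define I where "I = enn2ereal (\<integral>\<^sup>+\<omega>. impulse_cost X c (\<lambda>s. 1 / h) \<tau> (ennreal (real n * h)) \<omega> \<partial>N)"
  have shift: "(\<Sum>i=1..n. f i) - (\<Sum>i<n. f i) = f n - f 0" for f :: "nat \<Rightarrow> real"
    by (induction n) simp_all
  have "A - B = (\<integral>\<omega>. (\<Sum>i=1..n. g (post_state i \<omega>)) - (\<Sum>i<n. 1 * g (post_state i \<omega>)) \<partial>N)"
    unfolding A_def B_def using int
    by (intro Bochner_Integration.integral_diff[symmetric] Bochner_Integration.integrable_sum) auto
  also have "\<dots> = (\<integral>\<omega>. g (post_state n \<omega>) - g (post_state 0 \<omega>) \<partial>N)"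
    using shift by simp
  finally have eq: "A - B = (\<integral>\<omega>. g (post_state n \<omega>) - g (post_state 0 \<omega>) \<partial>N)" .
  have "\<bar>A - B\<bar> \<le> (\<integral>\<omega>. \<bar>g (post_state n \<omega>) - g (post_state 0 \<omega>)\<bar> \<partial>N)"
    unfolding eq by (rule integral_abs_bound)
  also have "\<dots> \<le> (\<integral>\<omega>. 2 * C \<partial>N)"
  proof (rule integral_mono)
    fix \<omega>
    show "\<bar>g (post_state n \<omega>) - g (post_state 0 \<omega>)\<bar> \<le> 2 * C"
      using C[of "post_state n \<omega>"] C[of "post_state 0 \<omega>"] by linarith
  qed (use int in auto)
  finally have AB: "\<bar>A - B\<bar> \<le> 2 * C"
    by (simp add: N.prob_space)
  have le: "ereal a + I \<le> (ereal b + I) + ereal (2 * C)" if "a - b \<le> 2 * C" for a b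
  proof -
    have "ereal a \<le> ereal b + ereal (2 * C)"
      using that by simp
    then have "ereal a + I \<le> (ereal b + ereal (2 * C)) + I"
      by (rule add_right_mono)
    then show ?thesis
      by (simp only: ac_simps)
  qed
  show "expected_avg_cost g c n \<le> expected_total_cost g c (\<lambda>_. 1) (\<lambda>s. 1 / h) n + ereal (2 * C)"
    unfolding expected_avg_cost_def expected_total_cost_def A_def[symmetric] B_def[symmetric] I_def[symmetric]
    using AB by (intro le) linarith
  show "expected_total_cost g c (\<lambda>_. 1) (\<lambda>s. 1 / h) n \<le> expected_avg_cost g c n + ereal (2 * C)"
    unfolding expected_avg_cost_def expected_total_cost_def A_def[symmetric] B_def[symmetric] I_def[symmetric]
    using AB by (intro le) linarith
qed

end

section \<open>The strategy associated with a solution of the Bellman equation\<close>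

lemma ennreal_divide_le_nat_iff:
  assumes "0 < h"
  shows "a / ennreal h \<le> of_nat n \<longleftrightarrow> a \<le> ennreal (real n * h)"
proof (cases a)
  case (real r)
  then show ?thesis
    using assms by (simp add: divide_ennreal ennreal_of_nat_eq_real_of_nat ennreal_le_iff divide_le_eq)
next
  case top
  then show ?thesis
    using assms by (simp add: ennreal_top_divide top.extremum_unique ennreal_of_nat_eq_real_of_nat)
qed

definition intervention_region :: "('e \<Rightarrow> 'e \<Rightarrow> real) \<Rightarrow> 'e set \<Rightarrow> real \<Rightarrow> ('e \<Rightarrow> real) \<Rightarrow> 'e set" where
  "intervention_region c U h w = {y. w y = impulse_op c U h w y}"

text \<open>
  The infimum over a nonempty set of naturals is attained, so the impulse time is a grid point.
\<close>

lemma opt_time_Suc_eq: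
  fixes S :: "nat set"
  assumes h: "0 < h"
    and S: "S = {n. opt_time X c U h w i \<omega> \<le> ennreal (real n * h) \<and>
      X (real n * h) (\<omega> (Suc i)) \<in> intervention_region c U h w}"
  shows "opt_time X c U h w (Suc i) \<omega> = (if S = {} then \<top> else ennreal (real (LEAST n. n \<in> S) * h))"
proof -
  have eq: "opt_time X c U h w (Suc i) \<omega> = ennreal h * (INF n\<in>S. of_nat n)"
    by (simp add: S intervention_region_def ennreal_divide_le_nat_iff[OF h])
  show ?thesis
  proof (cases "S = {}")
    case True
    then show ?thesis
      using eq h by (simp add: ennreal_mult_top)
  next
    case False
    have "(INF n\<in>S. of_nat n :: ennreal) = of_nat (LEAST n. n \<in> S)"
    proof (rule antisym)
      show "(INF n\<in>S. of_nat n :: ennreal) \<le> of_nat (LEAST n. n \<in> S)"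
        using False by (intro INF_lower) (auto intro: LeastI)
      show "of_nat (LEAST n. n \<in> S) \<le> (INF n\<in>S. of_nat n :: ennreal)"
        by (intro INF_greatest) (simp add: Least_le)
    qed
    then show ?thesis
      using eq False h by (simp add: ennreal_of_nat_eq_real_of_nat mult.commute flip: ennreal_mult)
  qed
qed

lemma opt_time_le_iff:
  assumes h: "0 < h"
  shows "opt_time X c U h w (Suc i) \<omega> \<le> ennreal (real n * h) \<longleftrightarrow>
    (\<exists>m\<le>n. opt_time X c U h w i \<omega> \<le> ennreal (real m * h) \<and>
      X (real m * h) (\<omega> (Suc i)) \<in> intervention_region c U h w)"
proof -
  define S where "S = {n. opt_time X c U h w i \<omega> \<le> ennreal (real n * h) \<and>
      X (real n * h) (\<omega> (Suc i)) \<in> intervention_region c U h w}"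
  have "(if S = {} then \<top> else ennreal (real (LEAST n. n \<in> S) * h)) \<le> ennreal (real n * h) \<longleftrightarrow>
    (\<exists>m\<le>n. m \<in> S)"
  proof (cases "S = {}")
    case False
    then have "(LEAST n. n \<in> S) \<in> S"
      by (auto intro: LeastI)
    moreover have "ennreal (real (LEAST n. n \<in> S) * h) \<le> ennreal (real n * h) \<longleftrightarrow> (LEAST n. n \<in> S) \<le> n"
      using h by (auto simp: ennreal_le_iff2 mult_le_0_iff)
    ultimately show ?thesis
      using False by (auto intro: order_trans[OF Least_le])
  qed (simp add: top.extremum_unique)
  then show ?thesis
    unfolding opt_time_Suc_eq[OF h S_def] by (simp add: S_def)
qed

lemma opt_time_grid:
  assumes "0 < h"
  shows "opt_time X c U h w i \<omega> \<in> insert \<top> (range (\<lambda>n::nat. ennreal (real n * h)))"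
proof (cases i)
  case 0
  then show ?thesis
    by (auto intro!: image_eqI[of _ _ 0])
next
  case (Suc j)
  then show ?thesis
    by (simp add: opt_time_Suc_eq[OF assms refl] del: opt_time.simps)
qed

lemma opt_time_le_Suc:
  assumes "0 < h"
  shows "opt_time X c U h w i \<omega> \<le> opt_time X c U h w (Suc i) \<omega>"
proof -
  consider "opt_time X c U h w (Suc i) \<omega> = \<top>"
    | n :: nat where "opt_time X c U h w (Suc i) \<omega> = ennreal (real n * h)"
    using opt_time_grid[OF assms, of X c U w "Suc i" \<omega>] by blast
  then show ?thesis
  proof cases
    case 1
    then show ?thesis by (simp only: top_greatest)
  next
    case 2
    then obtain m where m: "m \<le> n" "opt_time X c U h w i \<omega> \<le> ennreal (real m * h)"
      using opt_time_le_iff[OF assms, of X c U w i \<omega> n] by auto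
    have "ennreal (real m * h) \<le> ennreal (real n * h)"
      using m(1) assms by (intro ennreal_leI mult_right_mono) auto
    then show ?thesis
      unfolding 2 using m(2) by (rule order_trans[rotated])
  qed
qed

text \<open>
  By minimality, the grid point that witnesses \<open>opt_time (Suc i) \<le> n h\<close> is \<open>n\<close> itself.
\<close>

lemma opt_time_eqD:
  assumes h: "0 < h" and "opt_time X c U h w (Suc i) \<omega> = ennreal (real n * h)"
  shows "X (real n * h) (\<omega> (Suc i)) \<in> intervention_region c U h w"
proof -
  obtain m where m: "m \<le> n" "opt_time X c U h w i \<omega> \<le> ennreal (real m * h)"
    "X (real m * h) (\<omega> (Suc i)) \<in> intervention_region c U h w"
    using opt_time_le_iff[OF h, of X c U w i \<omega> n] assms(2) by auto
  then have "ennreal (real n * h) \<le> ennreal (real m * h)"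
    using opt_time_le_iff[OF h, of X c U w i \<omega> m] assms(2) by auto
  then have "n \<le> m"
    using h by (auto simp: ennreal_le_iff2 mult_le_0_iff)
  then show ?thesis
    using m by simp
qed

lemma impulse_op_eq_selected:
  assumes "is_arg_min (\<lambda>\<xi>. 1 / h * c y \<xi> + w \<xi>) (\<lambda>\<xi>. \<xi> \<in> U) (s :: 'e)"
  shows "s \<in> U" "impulse_op c U h w y = 1 / h * c y s + w s"
proof -
  show s: "s \<in> U"
    using assms by (simp add: is_arg_min_def)
  show "impulse_op c U h w y = 1 / h * c y s + w s"
    unfolding impulse_op_def
    using assms s by (intro cInf_eq_minimum) (auto simp: is_arg_min_def not_less)
qed

lemma impulse_op_le:
  assumes s: "is_arg_min (\<lambda>\<xi>. 1 / h * c y \<xi> + w \<xi>) (\<lambda>\<xi>. \<xi> \<in> U) (s :: 'e)" and "\<eta> \<in> U"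
  shows "impulse_op c U h w y \<le> 1 / h * c y \<eta> + w \<eta>"
  using assms unfolding impulse_op_eq_selected(2)[where c=c and h=h and w=w and U=U, OF s] by (auto simp: is_arg_min_def not_less)

text \<open>
  With the selector, \<open>impulse_op\<close> is a composition of measurable maps. The cost \<open>c\<close> is only known
  to be continuous on \<open>UNIV \<times> U\<close>, where the graph of the selector lies.
\<close>

lemma intervention_region_measurable:
  fixes c :: "'e::{metric_space, second_countable_topology} \<Rightarrow> 'e \<Rightarrow> real" and U :: "'e set"
  assumes U: "compact U" and c: "continuous_on (UNIV \<times> U) (\<lambda>(y, \<xi>). c y \<xi>)"
    and w[measurable]: "w \<in> borel_measurable borel" and sel_m[measurable]: "sel \<in> borel \<rightarrow>\<^sub>M borel"
    and sel: "\<And>y. is_arg_min (\<lambda>\<xi>. 1 / h * c y \<xi> + w \<xi>) (\<lambda>\<xi>. \<xi> \<in> U) (sel y)"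
  shows "intervention_region c U h w \<in> sets borel"
proof -
  have "(\<lambda>(y, \<xi>). c y \<xi>) \<in> borel_measurable (restrict_space borel (UNIV \<times> U))"
    by (rule borel_measurable_continuous_on_restrict[OF c])
  moreover have "(\<lambda>y. (y, sel y)) \<in> borel \<rightarrow>\<^sub>M restrict_space borel (UNIV \<times> U)"
    using impulse_op_eq_selected(1)[where c=c and h=h and w=w and U=U, OF sel]
    by (intro measurable_restrict_space2) (auto simp: borel_prod[symmetric])
  ultimately have [measurable]: "(\<lambda>y. c y (sel y)) \<in> borel_measurable borel"
    by (auto dest: measurable_compose)
  have "intervention_region c U h w = {y. w y = 1 / h * c y (sel y) + w (sel y)}"
    unfolding intervention_region_def using impulse_op_eq_selected(2)[where c=c and h=h and w=w and U=U, OF sel] by auto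
  also have "\<dots> \<in> sets borel"
    by simp
  finally show ?thesis .
qed

context standard_markov_process
begin

lemma opt_time_le_coord:
  assumes h: "0 < h" and J: "intervention_region c U h w \<in> sets borel"
  shows "{\<omega> \<in> space (path_space M). opt_time X c U h w i \<omega> \<le> ennreal (real n * h)} \<in>
    sets (coord_filtration M F i (ennreal (real n * h)))"
proof (induction i arbitrary: n)
  case 0
  have "{\<omega> \<in> space (path_space M). opt_time X c U h w 0 \<omega> \<le> ennreal (real n * h)} =
      space (coord_filtration M F 0 (ennreal (real n * h)))"
    by simp
  then show ?case by (metis sets.top)
next
  case (Suc i)
  let ?G = "coord_filtration M F (Suc i) (ennreal (real n * h))"
  have "{\<omega> \<in> space (path_space M). opt_time X c U h w (Suc i) \<omega> \<le> ennreal (real n * h)} =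
    (\<Union>m\<le>n. {\<omega> \<in> space (path_space M). opt_time X c U h w i \<omega> \<le> ennreal (real m * h)} \<inter>
      ((\<lambda>\<omega>. X (real m * h) (\<omega> (Suc i))) -` intervention_region c U h w \<inter> space ?G))"
    unfolding opt_time_le_iff[OF h] by auto
  also have "\<dots> \<in> sets ?G"
  proof (rule sets.finite_UN)
    fix m assume "m \<in> {..n}"
    then have mn: "ennreal (real m * h) \<le> ennreal (real n * h)"
      using h by (intro ennreal_leI mult_right_mono) auto
    have "{\<omega> \<in> space (path_space M). opt_time X c U h w i \<omega> \<le> ennreal (real m * h)} \<in> sets ?G"
      using Suc[of m] coord_filtration_mono[of i "Suc i", OF _ mn] by auto
    moreover have "(\<lambda>\<omega>. X (real m * h) (\<omega> (Suc i))) -` intervention_region c U h w \<inter> space ?G \<in> sets ?G"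
      using h by (intro measurable_sets[OF X_coord_adapted J] mn) auto
    ultimately show "{\<omega> \<in> space (path_space M). opt_time X c U h w i \<omega> \<le> ennreal (real m * h)} \<inter>
        ((\<lambda>\<omega>. X (real m * h) (\<omega> (Suc i))) -` intervention_region c U h w \<inter> space ?G) \<in> sets ?G"
      by (rule sets.Int)
  qed simp
  finally show ?case .
qed

lemma grid_stopping_timeI:
  assumes h: "0 < h"
    and T: "\<And>\<omega>. \<omega> \<in> space (path_space M) \<Longrightarrow> T \<omega> \<in> insert \<top> (range (\<lambda>n::nat. ennreal (real n * h)))"
    and le: "\<And>n. {\<omega> \<in> space (path_space M). T \<omega> \<le> ennreal (real n * h)} \<in>
      sets (coord_filtration M F i (ennreal (real n * h)))"
  shows "stopping_time (coord_filtration M F i) T"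
proof
  fix t :: ennreal
  let ?G = "coord_filtration M F i t"
  show "Measurable.pred ?G (\<lambda>\<omega>. T \<omega> \<le> t)"
  proof (cases "t = \<top>")
    case False
    have "{\<omega> \<in> space ?G. T \<omega> \<le> t} = (\<Union>n\<in>{n::nat. ennreal (real n * h) \<le> t}.
        {\<omega> \<in> space (path_space M). T \<omega> \<le> ennreal (real n * h)})" (is "?l = ?r")
    proof (rule set_eqI, rule iffI)
      fix \<omega> assume "\<omega> \<in> ?l"
      then show "\<omega> \<in> ?r"
        using T[of \<omega>] False by (auto simp: top.extremum_unique)
    qed (auto intro: order_trans)
    also have "\<dots> \<in> sets ?G"
      using le coord_filtration_mono[of i i] by (intro sets.countable_UN') auto
    finally show ?thesis by (simp add: pred_def)
  qed simp
qed

text \<open>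
  The impulse times are stopping times since the event \<open>opt_time i \<le> n h\<close> is decided by the first
  \<open>i\<close> coordinates at the times \<open>0, h, \<dots>, n h\<close>. For the after-impulse states the event
  \<open>\<xi> i \<in> B\<close> is split according to the value of the impulse time: \<open>A n\<close> is the part with value
  \<open>n h\<close> and \<open>A\<^sub>0\<close> the part with value \<open>\<infinity>\<close>, which is only visible at \<open>t = \<infinity>\<close>.
\<close>

lemma opt_strategy_in_grid_strategies:
  assumes h: "0 < h" and J: "intervention_region c U h w \<in> sets borel"
    and sel_m: "sel \<in> borel \<rightarrow>\<^sub>M borel" and sel: "\<And>y. sel y \<in> U" and \<xi>\<^sub>0: "\<xi>\<^sub>0 \<in> U"
  shows "opt_strategy X c U h w sel \<xi>\<^sub>0 \<in> grid_strategies M F U h"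
proof -
  let ?\<tau> = "opt_time X c U h w"
  let ?\<xi> = "snd (opt_strategy X c U h w sel \<xi>\<^sub>0)"
  let ?\<Omega> = "space (path_space M)"
  have grid: "?\<tau> i \<omega> \<in> insert \<top> (range (\<lambda>n::nat. ennreal (real n * h)))" for i \<omega>
    by (rule opt_time_grid[OF h])
  have stop: "stopping_time (coord_filtration M F i) (?\<tau> i)" for i
    by (rule grid_stopping_timeI[OF h grid opt_time_le_coord[OF h J]])
  have xi: "?\<xi> i \<in> filtration.pre_sigma ?\<Omega> (coord_filtration M F i) (?\<tau> i) \<rightarrow>\<^sub>M borel" if i: "1 \<le> i" for i
  proof -
    interpret G: filtration ?\<Omega> "coord_filtration M F i" by (rule filtration_coord)
    show ?thesis
    proof (rule measurableI)
      fix B :: "'e set" assume B: "B \<in> sets borel"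
      show "?\<xi> i -` B \<inter> space (G.pre_sigma (?\<tau> i)) \<in> sets (G.pre_sigma (?\<tau> i))"
      proof (rule G.sets_pre_sigmaI[OF stop])
        fix t
        let ?G = "coord_filtration M F i t"
        define A where "A n = {\<omega> \<in> ?\<Omega>. ?\<tau> i \<omega> = ennreal (real n * h)} \<inter>
          ((\<lambda>\<omega>. X (real n * h) (\<omega> i)) -` (sel -` B) \<inter> space ?G)" for n :: nat
        define A\<^sub>0 where "A\<^sub>0 = (if t = \<top> \<and> \<xi>\<^sub>0 \<in> B then ?\<Omega> - (\<Union>n. {\<omega> \<in> ?\<Omega>. ?\<tau> i \<omega> = ennreal (real n * h)}) else {})"
        have "\<exists>n::nat. ?\<tau> i \<omega> = ennreal (real n * h)" if "?\<tau> i \<omega> < \<top>" for \<omega>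
          using grid[of i \<omega>] that by auto
        then have "{\<omega> \<in> ?\<Omega>. ?\<tau> i \<omega> = ennreal (real n * h)} =
          {\<omega> \<in> ?\<Omega>. ?\<tau> i \<omega> \<le> ennreal (real n * h)} - (\<Union>l<n. {\<omega> \<in> ?\<Omega>. ?\<tau> i \<omega> \<le> ennreal (real l * h)})" for n
          by (intro grid_time_eq_set[OF h])
        moreover have le: "{\<omega> \<in> ?\<Omega>. ?\<tau> i \<omega> \<le> ennreal (real m * h)} \<in> sets ?G"
          if "ennreal (real n * h) \<le> t" "m \<le> n" for m n
        proof -
          have "ennreal (real m * h) \<le> ennreal (real n * h)"
            using h that(2) by (intro ennreal_leI mult_right_mono) auto
          then show ?thesis
            using opt_time_le_coord[OF h J, of i m] coord_filtration_mono[of i i] that(1)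
            by (meson order_trans order_refl subsetD)
        qed
        ultimately have eq: "{\<omega> \<in> ?\<Omega>. ?\<tau> i \<omega> = ennreal (real n * h)} \<in> sets ?G"
          if "ennreal (real n * h) \<le> t" for n
          using le[OF that] by (auto intro!: sets.Diff sets.finite_UN)
        have sel_B: "sel -` B \<in> sets borel"
          using measurable_sets[OF sel_m B] by simp
        have "A n \<in> sets ?G" if "ennreal (real n * h) \<le> t" for n
        proof -
          have "(\<lambda>\<omega>. X (real n * h) (\<omega> i)) \<in> ?G \<rightarrow>\<^sub>M borel"
            using i h that by (intro X_coord_adapted) auto
          from measurable_sets[OF this sel_B] show ?thesis
            unfolding A_def using eq[OF that] by (rule sets.Int[rotated])
        qed
        moreover have "A\<^sub>0 \<in> sets ?G"
        proof (cases "t = \<top> \<and> \<xi>\<^sub>0 \<in> B")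
          case True
          have "space ?G - (\<Union>n. {\<omega> \<in> ?\<Omega>. ?\<tau> i \<omega> = ennreal (real n * h)}) \<in> sets ?G"
            using eq True by (intro sets.compl_sets sets.countable_UN) auto
          then show ?thesis
            using True by (simp add: A\<^sub>0_def)
        next
          case False
          then show ?thesis
            unfolding A\<^sub>0_def by (metis sets.empty_sets)
        qed
        moreover have "{\<omega> \<in> ?\<xi> i -` B \<inter> ?\<Omega>. ?\<tau> i \<omega> \<le> t} =
          (\<Union>n\<in>{n. ennreal (real n * h) \<le> t}. A n) \<union> A\<^sub>0" (is "?l = ?r")
        proof (rule set_eqI)
          fix \<omega>
          consider "?\<tau> i \<omega> = \<top>" | n where "?\<tau> i \<omega> = ennreal (real n * h)"
            using grid[of i \<omega>] by auto
          then show "\<omega> \<in> ?l \<longleftrightarrow> \<omega> \<in> ?r"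
          proof cases
            case 1
            then show ?thesis
              by (auto simp: A_def A\<^sub>0_def opt_strategy_def top.extremum_unique)
          next
            case 2
            then show ?thesis
              using h by (auto simp: A_def A\<^sub>0_def opt_strategy_def)
          qed
        qed
        ultimately show "{\<omega> \<in> ?\<xi> i -` B \<inter> space (G.pre_sigma (?\<tau> i)). ?\<tau> i \<omega> \<le> t} \<in> sets ?G"
          unfolding G.space_pre_sigma by (auto intro!: sets.Un sets.countable_UN')
      qed
    qed simp
  qed
  have "?\<xi> i \<omega> \<in> U" for i \<omega>
    using sel \<xi>\<^sub>0 by (simp add: opt_strategy_def)
  moreover have "incseq (\<lambda>i. ?\<tau> i \<omega>)" for \<omega>
    by (rule incseq_SucI) (rule opt_time_le_Suc[OF h])
  ultimately have "(?\<tau>, ?\<xi>) \<in> grid_strategies M F U h"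
    using stop xi grid unfolding grid_strategies_def strategies_def by simp
  moreover have V: "opt_strategy X c U h w sel \<xi>\<^sub>0 = (?\<tau>, ?\<xi>)"
    by (simp add: opt_strategy_def)
  ultimately show ?thesis
    by (subst V)
qed

end

context controlled_grid_process
begin

text \<open>
  Impulses are made only in the intervention region, where \<open>w = M w\<close>, and almost surely lead to a
  minimiser in the definition of \<open>M w\<close>.
\<close>

lemma opt_strategy_jump:
  assumes V: "(\<tau>, \<xi>) = opt_strategy X c U h w sel \<xi>\<^sub>0"
    and sel: "\<And>y. is_arg_min (\<lambda>\<xi>. 1 / h * c y \<xi> + w \<xi>) (\<lambda>\<xi>. \<xi> \<in> U) (sel y)"
    and c: "\<And>y \<eta>. \<eta> \<in> U \<Longrightarrow> c\<^sub>0 \<le> c y \<eta>"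
  shows "AE \<omega> in N. \<forall>i\<ge>1. \<tau> i \<omega> < \<top> \<longrightarrow>
      (let s = impulse_instant i \<omega>; y = X s (\<omega> i); y' = X s (\<omega> (i + 1)) in
        c\<^sub>0 \<le> c y y' \<and> w y = 1 / h * c y y' + w y')"
  using AE_after_impulse AE_space
proof eventually_elim
  case (elim \<omega>)
  have \<tau>: "\<tau> = opt_time X c U h w"
    and \<xi>: "\<xi> = (\<lambda>i \<omega>. if \<tau> i \<omega> < \<top> then sel (X (impulse_instant i \<omega>) (\<omega> i)) else \<xi>\<^sub>0)"
    using V by (auto simp: opt_strategy_def)
  show ?case
  proof (intro allI impI)
    fix i assume i: "1 \<le> i" "\<tau> i \<omega> < \<top>"
    let ?s = "impulse_instant i \<omega>"
    obtain n where n: "\<tau> i \<omega> = ennreal (real n * h)"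
      using tau_grid[OF elim(2) i(2)] .
    then have s: "?s = real n * h"
      using h_pos by simp
    obtain j where j: "i = Suc j"
      using i(1) by (cases i) auto
    have "X ?s (\<omega> i) \<in> intervention_region c U h w"
      using opt_time_eqD[OF h_pos, of X c U w j \<omega> n] n unfolding s unfolding \<tau> j by simp
    moreover have "X ?s (\<omega> (i + 1)) = sel (X ?s (\<omega> i))"
      using elim(1)[rule_format, OF i] i(2) unfolding \<xi> by simp
    ultimately show "let s = ?s; y = X s (\<omega> i); y' = X s (\<omega> (i + 1)) in
        c\<^sub>0 \<le> c y y' \<and> w y = 1 / h * c y y' + w y'"
      using impulse_op_eq_selected[where c=c and h=h and w=w and U=U, OF sel] c by (simp add: Let_def intervention_region_def)
  qed
qed

text \<open>
  In the intervention region the next impulse would take place immediately, so coordinate \<open>phase m\<close>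
  would not be active at time \<open>m h\<close>.
\<close>

lemma opt_strategy_wait:
  assumes V: "(\<tau>, \<xi>) = opt_strategy X c U h w sel \<xi>\<^sub>0"
    and \<omega>: "\<omega> \<in> space N" "unfinished m \<omega>"
  shows "post_state m \<omega> \<notin> intervention_region c U h w"
proof
  assume J: "post_state m \<omega> \<in> intervention_region c U h w"
  have \<tau>: "\<tau> = opt_time X c U h w"
    using V by (auto simp: opt_strategy_def)
  obtain j where j: "phase m \<omega> = Suc j" "\<tau> j \<omega> \<le> ennreal (real m * h)" "ennreal (real m * h) < \<tau> (Suc j) \<omega>"
    using in_phase_phase[OF \<omega>] by (cases "phase m \<omega>") (auto simp: in_phase_def)
  have "X (real m * h) (\<omega> (Suc j)) \<in> intervention_region c U h w"
    using J by (simp add: post_state_def j(1))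
  with j(2) have "\<tau> (Suc j) \<omega> \<le> ennreal (real m * h)"
    unfolding \<tau> opt_time_le_iff[OF h_pos] by blast
  then show False
    using j(3) by (meson not_le)
qed

end

section \<open>Asymptotics of the weights\<close>

lemma integrable_on_Icc_of_continuous_on_nonneg:
  fixes \<beta> :: "real \<Rightarrow> real"
  assumes \<beta>: "continuous_on {0..} \<beta>" and "0 \<le> a"
  shows "\<beta> integrable_on {a..b}"
  using assms by (intro integrable_continuous_interval continuous_on_subset[OF \<beta>]) auto

text \<open>
  \<open>phi \<beta> h i\<close> is the mean of the decreasing function \<open>\<beta>\<close> over \<open>[i h, (i + 1) h]\<close>.
\<close>

lemma phi_bounds:
  assumes h: "0 < h" and \<beta>: "continuous_on {0..} \<beta>" "antimono_on {0..} \<beta>"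
  shows "\<beta> ((real i + 1) * h) \<le> phi \<beta> h (real i)" "phi \<beta> h (real i) \<le> \<beta> (real i * h)"
proof -
  let ?I = "{real i * h..(real i + 1) * h}"
  have int: "\<beta> integrable_on ?I"
    using h by (intro integrable_on_Icc_of_continuous_on_nonneg[OF \<beta>(1)]) simp
  have len: "(real i + 1) * h - real i * h = h"
    by (simp add: algebra_simps)
  have mono: "\<beta> t \<le> \<beta> s" if "0 \<le> s" "s \<le> t" for s t
    using \<beta>(2) that by (auto simp: monotone_on_def)
  have le: "real i * h \<le> (real i + 1) * h"
    using h by (simp add: algebra_simps)
  have nonneg: "0 \<le> real i * h"
    using h by simp
  have "integral ?I (\<lambda>_. \<beta> ((real i + 1) * h)) \<le> integral ?I \<beta>"
  proof (rule integral_le[OF integrable_const_ivl int])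
    fix t assume "t \<in> ?I"
    then show "\<beta> ((real i + 1) * h) \<le> \<beta> t"
      using nonneg by (intro mono) auto
  qed
  then have 1: "h * \<beta> ((real i + 1) * h) \<le> integral ?I \<beta>"
    using le len by simp
  have "integral ?I \<beta> \<le> integral ?I (\<lambda>_. \<beta> (real i * h))"
  proof (rule integral_le[OF int integrable_const_ivl])
    fix t assume "t \<in> ?I"
    then show "\<beta> t \<le> \<beta> (real i * h)"
      using nonneg by (intro mono) auto
  qed
  then have 2: "integral ?I \<beta> \<le> h * \<beta> (real i * h)"
    using le len by simp
  show "\<beta> ((real i + 1) * h) \<le> phi \<beta> h (real i)" "phi \<beta> h (real i) \<le> \<beta> (real i * h)"
    unfolding phi_def using 1 2 h by (simp_all add: field_simps)
qed

lemma phi_antimono: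
  assumes "0 < h" "continuous_on {0..} \<beta>" "antimono_on {0..} \<beta>"
  shows "antimono (\<lambda>i::nat. phi \<beta> h (real i))"
proof (rule decseq_SucI)
  fix i
  show "phi \<beta> h (real (Suc i)) \<le> phi \<beta> h (real i)"
    using phi_bounds(2)[OF assms, of "Suc i"] phi_bounds(1)[OF assms, of i] by (simp add: add.commute)
qed

text \<open>
  If the weights were summable, then so would be \<open>\<beta> (i h)\<close>, and the step function with these values
  would be an integrable majorant of \<open>\<beta>\<close>.
\<close>

lemma sum_phi_at_top:
  assumes h: "0 < h" and \<beta>: "continuous_on {0..} \<beta>" "antimono_on {0..} \<beta>"
    and pos: "\<And>t. 0 \<le> t \<Longrightarrow> 0 < \<beta> t"
    and infinite: "(\<integral>\<^sup>+s\<in>{0..}. ennreal (\<beta> s) \<partial>lborel) = \<infinity>"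
  shows "filterlim (\<lambda>n. \<Sum>i<n. phi \<beta> h (real i)) at_top sequentially"
proof -
  let ?\<phi> = "\<lambda>i. phi \<beta> h (real i)"
  have phi_pos: "0 < ?\<phi> i" for i
    using pos[of "(real i + 1) * h"] phi_bounds(1)[OF h \<beta>, of i] h by simp
  have "\<not> summable ?\<phi>"
  proof
    assume "summable ?\<phi>"
    then have "summable (\<lambda>i. \<beta> (real (Suc i) * h))"
      by (rule summable_comparison_test'[where N=0])
         (use phi_bounds(1)[OF h \<beta>] pos h in \<open>simp add: less_imp_le add.commute\<close>)
    then have summable: "summable (\<lambda>i. h * \<beta> (real i * h))"
      by (subst (asm) summable_Suc_iff) (rule summable_mult)
    have "(\<integral>\<^sup>+s\<in>{0..}. ennreal (\<beta> s) \<partial>lborel) \<le>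
        (\<integral>\<^sup>+s. (\<Sum>i. ennreal (\<beta> (real i * h)) * indicator {real i * h..(real i + 1) * h} s) \<partial>lborel)"
    proof (rule nn_integral_mono)
      fix s :: real
      show "ennreal (\<beta> s) * indicator {0..} s \<le>
        (\<Sum>i. ennreal (\<beta> (real i * h)) * indicator {real i * h..(real i + 1) * h} s)"
      proof (cases "0 \<le> s")
        case True
        define i where "i = nat \<lfloor>s / h\<rfloor>"
        have "real i \<le> s / h" "s / h \<le> real i + 1"
          using True h by (auto simp: i_def)
        then have i: "real i * h \<le> s" "s \<le> (real i + 1) * h"
          using h by (auto simp: field_simps)
        have "\<beta> s \<le> \<beta> (real i * h)"
          using \<beta>(2) i(1) h True by (auto simp: monotone_on_def)
        then have "ennreal (\<beta> s) * indicator {0..} s \<le>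
            ennreal (\<beta> (real i * h)) * indicator {real i * h..(real i + 1) * h} s"
          using i True by (simp add: ennreal_leI)
        also have "\<dots> \<le> (\<Sum>i. ennreal (\<beta> (real i * h)) * indicator {real i * h..(real i + 1) * h} s)"
        proof -
          have "f i \<le> suminf f" for f :: "nat \<Rightarrow> ennreal"
            using sum_le_suminf[of f "{i}"] by simp
          then show ?thesis .
        qed
        finally show ?thesis .
      qed simp
    qed
    also have "\<dots> = (\<Sum>i. \<integral>\<^sup>+s. ennreal (\<beta> (real i * h)) * indicator {real i * h..(real i + 1) * h} s \<partial>lborel)"
      by (rule nn_integral_suminf) simp
    also have "\<dots> = (\<Sum>i. ennreal (h * \<beta> (real i * h)))"
    proof (rule suminf_cong)
      fix i
      have "(real i + 1) * h - real i * h = h" "real i * h \<le> (real i + 1) * h"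
        using h by (simp_all add: algebra_simps)
      then show "(\<integral>\<^sup>+s. ennreal (\<beta> (real i * h)) * indicator {real i * h..(real i + 1) * h} s \<partial>lborel) =
          ennreal (h * \<beta> (real i * h))"
        using h pos[of "real i * h"]
        by (simp add: nn_integral_cmult_indicator mult.commute less_imp_le flip: ennreal_mult)
    qed
    also have "\<dots> = ennreal (\<Sum>i. h * \<beta> (real i * h))"
      using h pos by (intro suminf_ennreal2 summable) (simp add: less_imp_le)
    finally show False
      using infinite by (simp add: top.extremum_unique)
  qed
  then have unbounded: "\<exists>n. Z < (\<Sum>i<n. ?\<phi> i)" for Z
    using bounded_imp_summable[of ?\<phi> Z] phi_pos
    by (metis (no_types, lifting) lessThan_Suc_atMost less_imp_le not_le)
  show ?thesis
    unfolding filterlim_at_top eventually_sequentially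
  proof
    fix Z :: real
    obtain n where n: "Z < (\<Sum>i<n. ?\<phi> i)"
      using unbounded by blast
    have "(\<Sum>i<n. ?\<phi> i) \<le> (\<Sum>i<m. ?\<phi> i)" if "n \<le> m" for m
      using that phi_pos by (intro sum_mono2) (auto simp: less_imp_le)
    then show "\<exists>N. \<forall>n\<ge>N. Z \<le> (\<Sum>i<n. ?\<phi> i)"
      using n by (meson less_imp_le order_trans)
  qed
qed

lemma ratio_tendsto:
  fixes S :: "nat \<Rightarrow> real"
  assumes "filterlim S at_top sequentially"
  shows "(\<lambda>n. ereal (lam * S n + K) / ereal (S n)) \<longlonglongrightarrow> ereal lam"
proof -
  have "(\<lambda>n. lam + K / S n) \<longlonglongrightarrow> lam + 0"
    by (intro tendsto_add tendsto_const tendsto_divide_0[OF tendsto_const]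
        filterlim_at_top_imp_at_infinity assms)
  then have "(\<lambda>n. ereal (lam + K / S n)) \<longlonglongrightarrow> ereal lam"
    by simp
  moreover have "\<forall>\<^sub>F n in sequentially. ereal (lam + K / S n) = ereal (lam * S n + K) / ereal (S n)"
    using filterlim_at_top_dense[THEN iffD1, OF assms, rule_format, of 0]
    by eventually_elim (simp add: add_divide_distrib)
  ultimately show ?thesis
    by (rule Lim_transform_eventually)
qed

text \<open>
  Errors that are bounded uniformly in \<open>n\<close> do not influence the long-run ratio.
\<close>

lemma limsup_ratio_ge:
  fixes S :: "nat \<Rightarrow> real" and R :: "nat \<Rightarrow> ereal"
  assumes S: "filterlim S at_top sequentially" and R: "\<And>n. ereal (lam * S n + K) \<le> R n"
  shows "ereal lam \<le> limsup (\<lambda>n. R n / ereal (S n))"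
proof -
  have "ereal lam = limsup (\<lambda>n. ereal (lam * S n + K) / ereal (S n))"
    using lim_imp_Limsup[OF _ ratio_tendsto[OF S, of lam K]] by simp
  also have "\<dots> \<le> limsup (\<lambda>n. R n / ereal (S n))"
  proof (rule Limsup_mono)
    show "\<forall>\<^sub>F n in sequentially. ereal (lam * S n + K) / ereal (S n) \<le> R n / ereal (S n)"
      using filterlim_at_top_dense[THEN iffD1, OF S, rule_format, of 0]
      by eventually_elim (rule ereal_divide_right_mono[OF R], simp)
  qed
  finally show ?thesis .
qed

lemma limsup_ratio_le:
  fixes S :: "nat \<Rightarrow> real" and R :: "nat \<Rightarrow> ereal"
  assumes S: "filterlim S at_top sequentially" and R: "\<And>n. R n \<le> ereal (lam * S n + K)"
  shows "limsup (\<lambda>n. R n / ereal (S n)) \<le> ereal lam"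
proof -
  have "limsup (\<lambda>n. R n / ereal (S n)) \<le> limsup (\<lambda>n. ereal (lam * S n + K) / ereal (S n))"
  proof (rule Limsup_mono)
    show "\<forall>\<^sub>F n in sequentially. R n / ereal (S n) \<le> ereal (lam * S n + K) / ereal (S n)"
      using filterlim_at_top_dense[THEN iffD1, OF S, rule_format, of 0]
      by eventually_elim (rule ereal_divide_right_mono[OF R], simp)
  qed
  also have "\<dots> = ereal lam"
    using lim_imp_Limsup[OF _ ratio_tendsto[OF S, of lam K]] by simp
  finally show ?thesis .
qed

section \<open>The optimality theorem\<close>

theorem theorem3p8:
  fixes M :: "'w measure" and F :: "ennreal \<Rightarrow> 'w measure"
    and X :: "real \<Rightarrow> 'w \<Rightarrow> 'e::{metric_space, second_countable_topology}"
    and P :: "'e \<Rightarrow> 'w measure"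
    and U :: "'e set" and \<beta> :: "real \<Rightarrow> real" and g :: "'e \<Rightarrow> real" and c :: "'e \<Rightarrow> 'e \<Rightarrow> real"
    and PV :: "'e \<Rightarrow> ('w, 'e) strategy \<Rightarrow> (nat \<Rightarrow> 'w) measure"
    and h lam\<^sub>h :: real and w\<^sub>h :: "'e \<Rightarrow> real" and sel :: "'e \<Rightarrow> 'e" and \<xi>\<^sub>0 :: 'e
  assumes E_locally_compact: "locally compact (UNIV :: 'e set)"
    and process: "standard_markov_process M F X P"
    and U: "compact U" "U \<noteq> {}"
    and \<beta>_range: "\<And>t. 0 \<le> t \<Longrightarrow> 0 < \<beta> t \<and> \<beta> t \<le> 1"
    and \<beta>_decreasing: "antimono_on {0..} \<beta>"
    and \<beta>_continuous: "continuous_on {0..} \<beta>"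
    and \<beta>_zero: "\<beta> 0 = 1"
    and \<beta>_supermult: "\<And>t s. 0 \<le> t \<Longrightarrow> 0 \<le> s \<Longrightarrow> \<beta> t * \<beta> s \<le> \<beta> (t + s)"
    and \<beta>_integral: "(\<integral>\<^sup>+s\<in>{0..}. ennreal (\<beta> s) \<partial>lborel) = \<infinity>"
    and g: "g \<in> bcontfun"
    and c_continuous: "continuous_on (UNIV \<times> U) (\<lambda>(x, \<xi>). c x \<xi>)"
    and c_bounded: "bounded ((\<lambda>(x, \<xi>). c x \<xi>) ` (UNIV \<times> U))"
    and c_bounds: "\<exists>c\<^sub>0>0. \<forall>x. \<forall>\<xi>\<in>U. \<forall>\<eta>\<in>U. c\<^sub>0 \<le> c x \<xi> \<and> c x \<xi> \<le> c x \<eta> + c \<eta> \<xi>"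
    and feller: "\<And>f t. f \<in> bcontfun \<Longrightarrow> 0 < t \<Longrightarrow> (\<lambda>x. \<integral>\<omega>. f (X t \<omega>) \<partial>P x :: real) \<in> bcontfun"
    and ergodic: "\<And>t. 0 < t \<Longrightarrow> \<exists>\<Lambda>. 0 < \<Lambda> \<and> \<Lambda> < 1 \<and>
      (\<forall>x y. \<forall>A\<in>sets borel. \<bar>trans_prob P X t x A - trans_prob P X t y A\<bar> \<le> \<Lambda>)"
    and controlled: "\<And>x V. V \<in> strategies M F U \<Longrightarrow> controlled_law M F X P x V (PV x V)"
    and h: "0 < h"
    and w\<^sub>h: "w\<^sub>h \<in> bcontfun"
    and bellman: "\<And>x. w\<^sub>h x = min (g x - lam\<^sub>h + (\<integral>\<omega>. w\<^sub>h (X h \<omega>) \<partial>P x)) (impulse_op c U h w\<^sub>h x)"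
    and sel_measurable: "sel \<in> borel \<rightarrow>\<^sub>M borel"
    and sel: "\<And>x. is_arg_min (\<lambda>\<xi>. 1 / h * c x \<xi> + w\<^sub>h \<xi>) (\<lambda>\<xi>. \<xi> \<in> U) (sel x)"
    and \<xi>\<^sub>0: "\<xi>\<^sub>0 \<in> U"
  shows "\<forall>x. (INF V\<in>grid_strategies M F U h. J_disc X g c \<beta> PV h x V)
        = J_disc X g c \<beta> PV h x (opt_strategy X c U h w\<^sub>h sel \<xi>\<^sub>0)
    \<and> J_disc X g c \<beta> PV h x (opt_strategy X c U h w\<^sub>h sel \<xi>\<^sub>0) = ereal lam\<^sub>h
    \<and> ereal lam\<^sub>h = (INF V\<in>grid_strategies M F U h. J_avg X g c PV h x V)"
proof
  fix x
  interpret process: standard_markov_process M F X P by (rule process)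
  let ?V = "grid_strategies M F U h"
  let ?opt = "opt_strategy X c U h w\<^sub>h sel \<xi>\<^sub>0"
  let ?\<phi> = "\<lambda>i::nat. phi \<beta> h (real i)"
  let ?q = "\<lambda>s. 1 / h * phi \<beta> h (s / h)"
  let ?S = "\<lambda>n. \<Sum>i<n. ?\<phi> i"
  obtain W where w: "w\<^sub>h \<in> borel_measurable borel" and W: "\<And>y. \<bar>w\<^sub>h y\<bar> \<le> W"
    using bcontfun_measurable_bounded[OF w\<^sub>h] by blast
  obtain C where g_m: "g \<in> borel_measurable borel" and C: "\<And>y. \<bar>g y\<bar> \<le> C"
    using bcontfun_measurable_bounded[OF g] by blast
  obtain c\<^sub>0 where c0: "0 < c\<^sub>0" and c_ge: "\<And>y \<eta>. \<eta> \<in> U \<Longrightarrow> c\<^sub>0 \<le> c y \<eta>"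
    using c_bounds by meson
  have \<phi>_anti: "antimono ?\<phi>"
    by (rule phi_antimono[OF h \<beta>_continuous \<beta>_decreasing])
  have \<phi>_pos: "0 < ?\<phi> i" for i
    using phi_bounds(1)[OF h \<beta>_continuous \<beta>_decreasing, of i] \<beta>_range[of "(real i + 1) * h"] h by simp
  have q: "?q (real m * h) = 1 / h * ?\<phi> m" for m :: nat
    using h by simp
  have S: "filterlim ?S at_top sequentially"
    by (rule sum_phi_at_top[OF h \<beta>_continuous \<beta>_decreasing _ \<beta>_integral]) (use \<beta>_range in blast)
  have sub: "w\<^sub>h y \<le> g y - lam\<^sub>h + (\<integral>u. w\<^sub>h (X h u) \<partial>P y)" for y
    using bellman[of y] by simp
  have jump: "w\<^sub>h y \<le> 1 / h * c y \<eta> + w\<^sub>h \<eta>" if "\<eta> \<in> U" for y \<eta>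
  proof -
    have "w\<^sub>h y \<le> impulse_op c U h w\<^sub>h y"
      using bellman[of y] by simp
    also have "\<dots> \<le> 1 / h * c y \<eta> + w\<^sub>h \<eta>"
      by (rule impulse_op_le[OF sel that])
    finally show ?thesis .
  qed
  have controlled_grid: "controlled_grid_process M F X P U h (fst V) (snd V) x (PV x V)" if V: "V \<in> ?V" for V
  proof -
    have "V \<in> strategies M F U"
      using V by (auto simp: grid_strategies_def)
    then have "controlled_law M F X P x V (PV x V)"
      by (rule controlled)
    then show ?thesis
      using V h by unfold_locales auto
  qed
  have lower: "ereal lam\<^sub>h \<le> J_disc X g c \<beta> PV h x V" "ereal lam\<^sub>h \<le> J_avg X g c PV h x V" if V: "V \<in> ?V" for V
  proof -
    interpret V: controlled_grid_process M F X P U h "fst V" "snd V" x "PV x V"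
      by (rule controlled_grid[OF V])
    have disc: "ereal (lam\<^sub>h * ?S n + - (2 * W * ?\<phi> 0)) \<le> V.expected_total_cost g c ?\<phi> ?q n" for n
      using V.expected_total_cost_lower[where q="?q", OF w W g_m C \<phi>_anti \<phi>_pos q sub jump c0 c_ge, of n]
      by simp
    show "ereal lam\<^sub>h \<le> J_disc X g c \<beta> PV h x V"
      by (subst V.J_disc_eq) (simp_all only: prod.collapse limsup_ratio_ge[OF S disc])
    have avg: "ereal (lam\<^sub>h * real n + - (2 * W + 2 * C)) \<le> V.expected_avg_cost g c n" for n
    proof -
      have "ereal (lam\<^sub>h * (\<Sum>i<n. 1) - 2 * W * 1) \<le> V.expected_total_cost g c (\<lambda>_. 1) (\<lambda>s. 1 / h) n"
        by (rule V.expected_total_cost_lower[OF w W g_m C _ _ _ sub jump c0 c_ge])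
           (auto simp: monotone_def)
      also have "\<dots> \<le> V.expected_avg_cost g c n + ereal (2 * C)"
        by (rule V.expected_avg_cost_bounds(2)[OF g_m C])
      finally show ?thesis
        by (cases "V.expected_avg_cost g c n") auto
    qed
    show "ereal lam\<^sub>h \<le> J_avg X g c PV h x V"
      by (subst V.J_avg_eq) (simp_all only: prod.collapse limsup_ratio_ge[OF filterlim_real_sequentially avg])
  qed
  have opt: "?opt \<in> ?V"
  proof (rule process.opt_strategy_in_grid_strategies[OF h _ sel_measurable _ \<xi>\<^sub>0])
    show "intervention_region c U h w\<^sub>h \<in> sets borel"
      by (rule intervention_region_measurable[OF U(1) c_continuous w sel_measurable sel])
    show "sel y \<in> U" for y
      using sel[of y] by (simp add: is_arg_min_def)
  qed
  interpret O: controlled_grid_process M F X P U h "fst ?opt" "snd ?opt" x "PV x ?opt"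
    by (rule controlled_grid[OF opt])
  have jumps: "AE \<omega> in PV x ?opt. \<forall>i\<ge>1. fst ?opt i \<omega> < \<top> \<longrightarrow>
      (let s = enn2real (fst ?opt i \<omega>); y = X s (\<omega> i); y' = X s (\<omega> (i + 1)) in
        c\<^sub>0 \<le> c y y' \<and> w\<^sub>h y = 1 / h * c y y' + w\<^sub>h y')"
    by (rule O.opt_strategy_jump[OF prod.collapse sel c_ge])
  have fin: "AE \<omega> in PV x ?opt. O.unfinished n \<omega>" for n
  proof (rule O.AE_unfinished[OF W])
    show "0 < 1 / h * c\<^sub>0"
      using h c0 by simp
    show "AE \<omega> in PV x ?opt. \<forall>i\<ge>1. fst ?opt i \<omega> < \<top> \<longrightarrow>
      1 / h * c\<^sub>0 + w\<^sub>h (X (enn2real (fst ?opt i \<omega>)) (\<omega> (i + 1))) \<le> w\<^sub>h (X (enn2real (fst ?opt i \<omega>)) (\<omega> i))"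
      using jumps by eventually_elim (use h in \<open>auto simp: Let_def divide_right_mono\<close>)
  qed
  have jump_opt: "AE \<omega> in PV x ?opt. \<forall>i\<ge>1. fst ?opt i \<omega> < \<top> \<longrightarrow>
      (let s = enn2real (fst ?opt i \<omega>); y = X s (\<omega> i); y' = X s (\<omega> (i + 1)) in
        0 \<le> c y y' \<and> w\<^sub>h y = 1 / h * c y y' + w\<^sub>h y')"
    using jumps by eventually_elim (use c0 in \<open>fastforce simp: Let_def\<close>)
  have wait: "AE \<omega> in PV x ?opt. \<forall>m<n. w\<^sub>h (O.post_state m \<omega>) =
      g (O.post_state m \<omega>) - lam\<^sub>h + (\<integral>u. w\<^sub>h (X h u) \<partial>P (O.post_state m \<omega>))" for n
    using fin[of n] AE_space
  proof eventually_elim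
    case (elim \<omega>)
    show ?case
    proof (intro allI impI)
      fix m assume "m < n"
      then have "O.unfinished m \<omega>"
        using O.unfinished_antimono[OF elim(1)] by simp
      then have "w\<^sub>h (O.post_state m \<omega>) \<noteq> impulse_op c U h w\<^sub>h (O.post_state m \<omega>)"
        using O.opt_strategy_wait[OF prod.collapse elim(2)] by (simp add: intervention_region_def)
      then show "w\<^sub>h (O.post_state m \<omega>) =
          g (O.post_state m \<omega>) - lam\<^sub>h + (\<integral>u. w\<^sub>h (X h u) \<partial>P (O.post_state m \<omega>))"
        using bellman[of "O.post_state m \<omega>"] by (simp add: min_def split: if_splits)
    qed
  qed
  have disc: "O.expected_total_cost g c ?\<phi> ?q n \<le> ereal (lam\<^sub>h * ?S n + 2 * W * ?\<phi> 0)" for n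
    by (rule O.expected_total_cost_upper[OF fin w W g_m C \<phi>_anti \<phi>_pos q wait jump_opt])
  have "J_disc X g c \<beta> PV h x ?opt \<le> ereal lam\<^sub>h"
    by (subst O.J_disc_eq) (simp_all only: prod.collapse limsup_ratio_le[OF S disc])
  then have J_disc_opt: "J_disc X g c \<beta> PV h x ?opt = ereal lam\<^sub>h"
    using lower(1)[OF opt] by (rule antisym)
  have avg: "O.expected_avg_cost g c n \<le> ereal (lam\<^sub>h * real n + (2 * W + 2 * C))" for n
  proof -
    have "O.expected_total_cost g c (\<lambda>_. 1) (\<lambda>s. 1 / h) n \<le> ereal (lam\<^sub>h * (\<Sum>i<n. 1) + 2 * W * 1)"
      by (rule O.expected_total_cost_upper[OF fin w W g_m C _ _ _ wait jump_opt])
         (auto simp: monotone_def)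
    then have "O.expected_total_cost g c (\<lambda>_. 1) (\<lambda>s. 1 / h) n + ereal (2 * C) \<le>
        ereal (lam\<^sub>h * (\<Sum>i<n. 1) + 2 * W * 1) + ereal (2 * C)"
      by (rule add_right_mono)
    with O.expected_avg_cost_bounds(1)[OF g_m C, of c n] show ?thesis
      by (auto simp: algebra_simps intro: order_trans)
  qed
  have "J_avg X g c PV h x ?opt \<le> ereal lam\<^sub>h"
    by (subst O.J_avg_eq) (simp_all only: prod.collapse limsup_ratio_le[OF filterlim_real_sequentially avg])
  then have J_avg_opt: "J_avg X g c PV h x ?opt = ereal lam\<^sub>h"
    using lower(2)[OF opt] by (rule antisym)
  have "(INF V\<in>?V. J_disc X g c \<beta> PV h x V) = J_disc X g c \<beta> PV h x ?opt"
    using lower(1) J_disc_opt by (intro antisym INF_lower opt INF_greatest) simp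
  moreover have "ereal lam\<^sub>h = (INF V\<in>?V. J_avg X g c PV h x V)"
    using lower(2) J_avg_opt INF_lower[OF opt, of "J_avg X g c PV h x"]
    by (intro antisym INF_greatest) simp_all
  ultimately show "(INF V\<in>?V. J_disc X g c \<beta> PV h x V) = J_disc X g c \<beta> PV h x ?opt
    \<and> J_disc X g c \<beta> PV h x ?opt = ereal lam\<^sub>h
    \<and> ereal lam\<^sub>h = (INF V\<in>?V. J_avg X g c PV h x V)"
    using J_disc_opt by blast
qed

end
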